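(* Let $n\ge1$ and let $V$ be the complex vector space with basis $v_1,\ldots,v_n$. If $k=1,2,\ldots$ and $1\le i_1,\ldots,i_{k+1}\le n$, then in the action of $A_{k+1}(n)$ on $V^{\otimes (k+1)}$, $$\sigma_{k+\frac12}(v_{i_1}\otimes\cdots\otimes v_{i_{k+1}})=\big(s_{i_k,i_{k+1}}v_{i_1}\otimes\cdots\otimes s_{i_k,i_{k+1}}v_{i_{k-1}}\big)\otimes v_{i_k}\otimes v_{i_{k+1}}$$ (with $s_{i_k,i_{k+1}}$ applied to the first $k-1$ factors), and $$\sigma_{k+1}(v_{i_1}\otimes\cdots\otimes v_{i_{k+1}})=s_{i_k,i_{k+1}}v_{i_1}\otimes\cdots\otimes s_{i_k,i_{k+1}}v_{i_k}\otimes s_{i_k,i_{k+1}}v_{i_{k+1}}$$ (with $s_{i_k,i_{k+1}}$ applied to all $k+1$ factors).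
   Context: Partition algebras. For an integer $k\ge1$ let $A_k$ be the set of all set partitions of $\{1,\ldots,k,1',\ldots,k'\}$, and let $A_{k-\frac12}\subseteq A_k$ be the subset of those in which $k$ and $k'$ lie in the same block. A partition is drawn as a graph with top vertices $1,\ldots,k$ and bottom vertices $1',\ldots,k'$, whose connected components are the blocks. For $\rho_1,\rho_2\in A_k$, $\rho_1\circ\rho_2\in A_k$ is obtained by placing $\rho_1$ above $\rho_2$, identifying the bottom row of $\rho_1$ with the top row of $\rho_2$, and deleting components contained entirely in the middle row. Let $R=\mathbb{Z}[z]$, $z$ an indeterminate. $\mathcal{A}_k(z)$ is the free $R$-module on $A_k$ with product $\rho_1\rho_2=z^{\ell}\,\rho_1\circ\rho_2$, where $\ell$ is the number of components deleted from the middle row; $\mathcal{A}_{k-\frac12}(z)$ is the subalgebra generated by $A_{k-\frac12}$, and $\mathcal{A}_0(z)=R$. Adding the block $\{k+1,(k+1)'\}$ embeds $\mathcal{A}_k(z)$ in $\mathcal{A}_{k+\frac12}(z)\subseteq\mathcal{A}_{k+1}(z)$. For an integer $n\ge1$, $A_r(n)=\mathcal{A}_r(z)\otimes_{\mathbb{Z}[z]}\mathbb{C}$ with $z$ acting on $\mathbb{C}$ as $n$. Elements: $s_i$ ($i\ge1$) has blocks $\{i,(i+1)'\},\{i+1,i'\}$ and $\{m,m'\}$ for $m\ne i,i+1$; $p_j$ ($j\ge1$) has blocks $\{j\},\{j'\}$ and $\{m,m'\}$ for $m\ne j$; $p_{i+\frac12}$ ($i\ge1$) has blocks $\{i,i+1,i',(i+1)'\}$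 and $\{m,m'\}$ for $m\neq i,i+1$. The algebra $\mathcal{A}_r(z)$ is generated by $s_1,\ldots,s_{r-1},p_1,\ldots,p_r,p_{1+\frac12},\ldots,p_{r-\frac12}$. Recursive definitions. $L_0=0$, $L_1=p_1$, $\sigma_1=1$, $\sigma_2=s_1$, and $L_{i+1}=-s_iL_ip_{i+\frac12}-p_{i+\frac12}L_is_i+p_{i+\frac12}L_ip_{i+1}p_{i+\frac12}+s_iL_is_i+\sigma_{i+1}$ for $i\ge1$, where for $i\ge2$ $\sigma_{i+1}=s_{i-1}s_i\sigma_is_is_{i-1}+s_ip_{i-\frac12}L_{i-1}s_ip_{i-\frac12}s_i+p_{i-\frac12}L_{i-1}s_ip_{i-\frac12}-s_ip_{i-\frac12}L_{i-1}s_{i-1}p_{i+\frac12}p_ip_{i-\frac12}-p_{i-\frac12}p_ip_{i+\frac12}s_{i-1}L_{i-1}p_{i-\frac12}s_i.$ Also $\sigma_{\frac12}=1$, $\sigma_{1+\frac12}=1$, and for $i\ge2$ $\sigma_{i+\frac12}=s_{i-1}s_i\sigma_{i-\frac12}s_is_{i-1}+p_{i-\frac12}L_{i-1}s_ip_{i-\frac12}s_i+s_ip_{i-\frac12}L_{i-1}s_ip_{i-\frac12}-p_{i-\frac12}L_{i-1}s_{i-1}p_{i+\frac12}p_ip_{i-\frac12}-s_ip_{i-\frac12}p_ip_{i+\frac12}s_{i-1}L_{i-1}p_{i-\frac12}s_i.$ Action on tensor space. $A_r(n)$ acts on $V^{\otimes r}$ by: $s_k$ ($1\le k\le r-1$)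 interchanges the $k$th and $(k+1)$st tensor factors; $p_{k+\frac12}(v_{i_1}\otimes\cdots\otimes v_{i_r})$ equals $v_{i_1}\otimes\cdots\otimes v_{i_r}$ if $i_k=i_{k+1}$ and $0$ otherwise ($1\le k\le r-1$); $p_k(v_{i_1}\otimes\cdots\otimes v_{i_r})=\sum_{j=1}^n v_{i_1}\otimes\cdots\otimes v_{i_{k-1}}\otimes v_j\otimes v_{i_{k+1}}\otimes\cdots\otimes v_{i_r}$ ($1\le k\le r$). For $1\le a,b\le n$, $s_{a,b}\in\mathfrak{S}_n$ is the transposition interchanging $a$ and $b$ (the identity if $a=b$), acting on $V$ by permuting the basis: $s_{a,b}v_c=v_{s_{a,b}(c)}$. *)

theory Defs
  imports
    "HOL-Library.Disjoint_Sets"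
    "HOL-Library.Poly_Mapping"
    "HOL-Computational_Algebra.Polynomial"
    "HOL-Combinatorics.Transposition"
    Complex_Main
begin

section \<open>Set partitions as diagrams\<close>

text \<open>
  \<open>Top i\<close> stands for \<open>i\<close> and \<open>Bot i\<close> for \<open>i'\<close>.  \<open>Mid i\<close> never occurs in a diagram; it is the
  \<open>i\<close>-th vertex of the middle row obtained when two diagrams are stacked.
\<close>

datatype vertex = Top nat | Mid nat | Bot nat

type_synonym diagram = "vertex set set"

definition vertices :: "nat \<Rightarrow> vertex set" where
  "vertices r = Top ` {1..r} \<union> Bot ` {1..r}"

definition diagrams :: "nat \<Rightarrow> diagram set" where
  "diagrams r = {P. partition_on (vertices r) P}"

fun to_upper :: "vertex \<Rightarrow> vertex" where
  "to_upper (Bot i) = Mid i"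
| "to_upper v = v"

fun to_lower :: "vertex \<Rightarrow> vertex" where
  "to_lower (Top i) = Mid i"
| "to_lower v = v"

definition stacked_blocks :: "diagram \<Rightarrow> diagram \<Rightarrow> vertex set set" where
  "stacked_blocks P Q = (\<lambda>B. to_upper ` B) ` P \<union> (\<lambda>B. to_lower ` B) ` Q"

definition stacked_edges :: "diagram \<Rightarrow> diagram \<Rightarrow> (vertex \<times> vertex) set" where
  "stacked_edges P Q = {(u, v). \<exists>B\<in>stacked_blocks P Q. u \<in> B \<and> v \<in> B}"

definition stacked_components :: "diagram \<Rightarrow> diagram \<Rightarrow> vertex set set" where
  "stacked_components P Q = \<Union>(stacked_blocks P Q) // (stacked_edges P Q)\<^sup>+"

definition diagram_comp :: "diagram \<Rightarrow> diagram \<Rightarrow> diagram" where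
  "diagram_comp P Q = (\<lambda>C. C - range Mid) ` stacked_components P Q - {{}}"

definition deleted_components :: "diagram \<Rightarrow> diagram \<Rightarrow> nat" where
  "deleted_components P Q = card {C \<in> stacked_components P Q. C \<subseteq> range Mid}"

definition through_blocks :: "nat \<Rightarrow> nat set \<Rightarrow> diagram" where
  "through_blocks r X = (\<lambda>m. {Top m, Bot m}) ` ({1..r} - X)"

definition id_diagram :: "nat \<Rightarrow> diagram" where
  "id_diagram r = through_blocks r {}"

definition s_diagram :: "nat \<Rightarrow> nat \<Rightarrow> diagram" where
  "s_diagram r i = {{Top i, Bot (i + 1)}, {Top (i + 1), Bot i}} \<union> through_blocks r {i, i + 1}"

definition p_diagram :: "nat \<Rightarrow> nat \<Rightarrow> diagram" where
  "p_diagram r j = {{Top j}, {Bot j}} \<union> through_blocks r {j}"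

definition p_half_diagram :: "nat \<Rightarrow> nat \<Rightarrow> diagram"
  \<comment> \<open>the diagram of \<open>p\<^bsub>i + 1/2\<^esub>\<close>\<close>
  where "p_half_diagram r i =
    {{Top i, Top (i + 1), Bot i, Bot (i + 1)}} \<union> through_blocks r {i, i + 1}"


section \<open>Partition algebras\<close>

text \<open>
  The partition algebra with parameter \<open>q\<close> over a commutative ring is the free module on
  \<^term>\<open>diagrams r\<close>; its elements are the finitely supported functions supported on that set.
  The integral form has coefficients in \<open>\<int>[z]\<close> and \<open>q = z\<close>.  Since it is a free module, its base
  change along \<open>\<int>[z] \<rightarrow> \<complex>\<close>, \<open>z \<mapsto> n\<close>, is the same construction with complex coefficients and
  \<open>q = n\<close>, and the canonical map is the evaluation of all coefficients at \<open>n\<close>.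
\<close>

definition partition_algebra :: "nat \<Rightarrow> (diagram \<Rightarrow>\<^sub>0 'a::zero) set" where
  "partition_algebra r = {x. Poly_Mapping.keys x \<subseteq> diagrams r}"

definition pa_mult ::
  "'a::comm_ring_1 \<Rightarrow> (diagram \<Rightarrow>\<^sub>0 'a) \<Rightarrow> (diagram \<Rightarrow>\<^sub>0 'a) \<Rightarrow> (diagram \<Rightarrow>\<^sub>0 'a)" where
  "pa_mult q x y =
    (\<Sum>P\<in>Poly_Mapping.keys x. \<Sum>Q\<in>Poly_Mapping.keys y.
      Poly_Mapping.single (diagram_comp P Q)
        (q ^ deleted_components P Q * Poly_Mapping.lookup x P * Poly_Mapping.lookup y Q))"

definition pa_basis :: "diagram \<Rightarrow> (diagram \<Rightarrow>\<^sub>0 'a::comm_ring_1)" where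
  "pa_basis P = Poly_Mapping.single P 1"

type_synonym pa_int = "diagram \<Rightarrow>\<^sub>0 int poly"

definition z_mult :: "pa_int \<Rightarrow> pa_int \<Rightarrow> pa_int" (infixl \<open>\<star>\<close> 70) where
  "x \<star> y = pa_mult [:0, 1:] x y"

definition specialize :: "nat \<Rightarrow> pa_int \<Rightarrow> (diagram \<Rightarrow>\<^sub>0 complex)" where
  "specialize n x = Poly_Mapping.map (\<lambda>c. poly (map_poly of_int c) (of_nat n)) x"

abbreviation one_el :: "nat \<Rightarrow> pa_int" where
  "one_el r \<equiv> pa_basis (id_diagram r)"

abbreviation s_el :: "nat \<Rightarrow> nat \<Rightarrow> pa_int" where
  "s_el r i \<equiv> pa_basis (s_diagram r i)"

abbreviation p_el :: "nat \<Rightarrow> nat \<Rightarrow> pa_int" where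
  "p_el r j \<equiv> pa_basis (p_diagram r j)"

abbreviation ph_el :: "nat \<Rightarrow> nat \<Rightarrow> pa_int" where
  "ph_el r i \<equiv> pa_basis (p_half_diagram r i)"


section \<open>The elements L_el and sigma_el\<close>

text \<open>
  \<open>L_el r i\<close>, \<open>sigma_el r i\<close> (for \<open>i \<le> r\<close>) and \<open>sigma_half_el r i\<close> (for \<open>i < r\<close>) are the
  images in the algebra on \<open>r\<close> strands of \<open>L\<^sub>i\<close>, \<open>\<sigma>\<^sub>i\<close> and \<open>\<sigma>\<^bsub>i + 1/2\<^esub>\<close> under the embeddings that add
  the blocks \<open>{m, m'}\<close>.  These embeddings are algebra homomorphisms that map the generators to
  the generators of the same name, so the recursion can be run inside the algebra on
  \<open>r\<close> strands.  There is no \<open>\<sigma>\<^sub>0\<close>; its value below is junk and is never used.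
\<close>

function (sequential) L_el :: "nat \<Rightarrow> nat \<Rightarrow> pa_int" and sigma_el :: "nat \<Rightarrow> nat \<Rightarrow> pa_int" where
  "L_el r 0 = 0"
| "L_el r (Suc 0) = p_el r 1"
| "L_el r (Suc (Suc j)) = (let i = Suc j in
      - (s_el r i \<star> L_el r (Suc j) \<star> ph_el r i)
      - ph_el r i \<star> L_el r (Suc j) \<star> s_el r i
      + ph_el r i \<star> L_el r (Suc j) \<star> p_el r (i + 1) \<star> ph_el r i
      + s_el r i \<star> L_el r (Suc j) \<star> s_el r i
      + sigma_el r (Suc (Suc j)))"
| "sigma_el r 0 = 0"
| "sigma_el r (Suc 0) = one_el r"
| "sigma_el r (Suc (Suc 0)) = s_el r 1"
| "sigma_el r (Suc (Suc (Suc j))) = (let i = Suc (Suc j) in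
      s_el r (i - 1) \<star> s_el r i \<star> sigma_el r (Suc (Suc j)) \<star> s_el r i \<star> s_el r (i - 1)
      + s_el r i \<star> ph_el r (i - 1) \<star> L_el r (Suc j) \<star> s_el r i \<star> ph_el r (i - 1) \<star> s_el r i
      + ph_el r (i - 1) \<star> L_el r (Suc j) \<star> s_el r i \<star> ph_el r (i - 1)
      - s_el r i \<star> ph_el r (i - 1) \<star> L_el r (Suc j) \<star> s_el r (i - 1)
          \<star> ph_el r i \<star> p_el r i \<star> ph_el r (i - 1)
      - ph_el r (i - 1) \<star> p_el r i \<star> ph_el r i \<star> s_el r (i - 1)
          \<star> L_el r (Suc j) \<star> ph_el r (i - 1) \<star> s_el r i)"
  by pat_completeness auto
termination
  by (relation "measure (case_sum (\<lambda>(r, i). 2 * i + 1) (\<lambda>(r, i). 2 * i))") auto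

fun sigma_half_el :: "nat \<Rightarrow> nat \<Rightarrow> pa_int" where
  "sigma_half_el r 0 = one_el r"
| "sigma_half_el r (Suc 0) = one_el r"
| "sigma_half_el r (Suc (Suc j)) = (let i = Suc (Suc j) in
      s_el r (i - 1) \<star> s_el r i \<star> sigma_half_el r (Suc j) \<star> s_el r i \<star> s_el r (i - 1)
      + ph_el r (i - 1) \<star> L_el r (i - 1) \<star> s_el r i \<star> ph_el r (i - 1) \<star> s_el r i
      + s_el r i \<star> ph_el r (i - 1) \<star> L_el r (i - 1) \<star> s_el r i \<star> ph_el r (i - 1)
      - ph_el r (i - 1) \<star> L_el r (i - 1) \<star> s_el r (i - 1)
          \<star> ph_el r i \<star> p_el r i \<star> ph_el r (i - 1)
      - s_el r i \<star> ph_el r (i - 1) \<star> p_el r i \<star> ph_el r i \<star> s_el r (i - 1)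
          \<star> L_el r (i - 1) \<star> ph_el r (i - 1) \<star> s_el r i)"


section \<open>Tensor space and the action\<close>

text \<open>
  \<open>V\<close> is the space of coordinate vectors with respect to \<open>v\<^sub>1, \<dots>, v\<^sub>n\<close>, and its \<open>r\<close>-th tensor power
  the space of coordinate arrays indexed by the lists of length \<open>r\<close> over \<open>{1..n}\<close>.
\<close>

definition V_space :: "nat \<Rightarrow> (nat \<Rightarrow>\<^sub>0 complex) set" where
  "V_space n = {w. Poly_Mapping.keys w \<subseteq> {1..n}}"

definition basis_vec :: "nat \<Rightarrow> (nat \<Rightarrow>\<^sub>0 complex)" where
  "basis_vec i = Poly_Mapping.single i 1"

definition tensor_space :: "nat \<Rightarrow> nat \<Rightarrow> (nat list \<Rightarrow>\<^sub>0 complex) set" where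
  "tensor_space n r = {t. Poly_Mapping.keys t \<subseteq> {js. length js = r \<and> set js \<subseteq> {1..n}}}"

text \<open>\<open>tensor_prod r w\<close> is \<open>w 1 \<otimes> \<dots> \<otimes> w r\<close>.\<close>

fun tensor_prod :: "nat \<Rightarrow> (nat \<Rightarrow> (nat \<Rightarrow>\<^sub>0 complex)) \<Rightarrow> (nat list \<Rightarrow>\<^sub>0 complex)" where
  "tensor_prod 0 w = Poly_Mapping.single [] 1"
| "tensor_prod (Suc r) w =
    (\<Sum>js\<in>Poly_Mapping.keys (tensor_prod r w). \<Sum>j\<in>Poly_Mapping.keys (w (Suc r)).
      Poly_Mapping.single (js @ [j])
        (Poly_Mapping.lookup (tensor_prod r w) js * Poly_Mapping.lookup (w (Suc r)) j))"

text \<open>The linear operator on \<open>V\<close> given by the transposition of the basis vectors \<open>v\<^sub>a\<close> and \<open>v\<^sub>b\<close>.\<close>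

definition swap_op :: "nat \<Rightarrow> nat \<Rightarrow> (nat \<Rightarrow>\<^sub>0 complex) \<Rightarrow> (nat \<Rightarrow>\<^sub>0 complex)" where
  "swap_op a b w =
    (\<Sum>c\<in>Poly_Mapping.keys w.
      Poly_Mapping.single (transpose a b c) (Poly_Mapping.lookup w c))"

definition pm_scale :: "complex \<Rightarrow> ('k \<Rightarrow>\<^sub>0 complex) \<Rightarrow> ('k \<Rightarrow>\<^sub>0 complex)" where
  "pm_scale c x = Poly_Mapping.map ((*) c) x"

text \<open>
  \<open>tensor_action n r \<Phi>\<close> says that \<open>\<Phi>\<close> is the left module structure on the \<open>r\<close>-th tensor power of \<open>V\<close>
  over the partition algebra at \<open>n\<close> in which the generators act by the given formulas.  It is
  determined by them on these carriers, as the listed elements generate the algebra; values of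
  \<open>\<Phi>\<close> outside the carriers are unconstrained.  Existence is \<open>tensor_action_exists\<close> below.
\<close>

definition tensor_action ::
  "nat \<Rightarrow> nat \<Rightarrow> ((diagram \<Rightarrow>\<^sub>0 complex) \<Rightarrow> (nat list \<Rightarrow>\<^sub>0 complex) \<Rightarrow> (nat list \<Rightarrow>\<^sub>0 complex)) \<Rightarrow> bool"
  where
  "tensor_action n r \<Phi> \<longleftrightarrow>
    (\<forall>x\<in>partition_algebra r. \<forall>t\<in>tensor_space n r. \<Phi> x t \<in> tensor_space n r) \<and>
    (\<forall>x\<in>partition_algebra r. \<forall>t\<in>tensor_space n r. \<forall>u\<in>tensor_space n r.
      \<Phi> x (t + u) = \<Phi> x t + \<Phi> x u) \<and>
    (\<forall>x\<in>partition_algebra r. \<forall>t\<in>tensor_space n r. \<forall>c. \<Phi> x (pm_scale c t) = pm_scale c (\<Phi> x t)) \<and>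
    (\<forall>x\<in>partition_algebra r. \<forall>y\<in>partition_algebra r. \<forall>t\<in>tensor_space n r.
      \<Phi> (x + y) t = \<Phi> x t + \<Phi> y t) \<and>
    (\<forall>x\<in>partition_algebra r. \<forall>t\<in>tensor_space n r. \<forall>c. \<Phi> (pm_scale c x) t = pm_scale c (\<Phi> x t)) \<and>
    (\<forall>t\<in>tensor_space n r. \<Phi> (pa_basis (id_diagram r)) t = t) \<and>
    (\<forall>x\<in>partition_algebra r. \<forall>y\<in>partition_algebra r. \<forall>t\<in>tensor_space n r.
      \<Phi> (pa_mult (of_nat n) x y) t = \<Phi> x (\<Phi> y t)) \<and>
    (\<forall>m w. 1 \<le> m \<and> m < r \<and> (\<forall>l\<in>{1..r}. w l \<in> V_space n) \<longrightarrow>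
      \<Phi> (pa_basis (s_diagram r m)) (tensor_prod r w) = tensor_prod r (w \<circ> transpose m (m + 1))) \<and>
    (\<forall>m i. 1 \<le> m \<and> m < r \<and> (\<forall>l\<in>{1..r}. i l \<in> {1..n}) \<longrightarrow>
      \<Phi> (pa_basis (p_half_diagram r m)) (tensor_prod r (\<lambda>l. basis_vec (i l))) =
        (if i m = i (m + 1) then tensor_prod r (\<lambda>l. basis_vec (i l)) else 0)) \<and>
    (\<forall>m i. 1 \<le> m \<and> m \<le> r \<and> (\<forall>l\<in>{1..r}. i l \<in> {1..n}) \<longrightarrow>
      \<Phi> (pa_basis (p_diagram r m)) (tensor_prod r (\<lambda>l. basis_vec (i l))) =
        (\<Sum>j=1..n. tensor_prod r (\<lambda>l. basis_vec ((i(m := j)) l))))"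


section \<open>Existence of the action\<close>

text \<open>
  A diagram acts by the 0/1 matrix with a 1 at \<open>(a, b)\<close> iff labelling the top row by \<open>a\<close> and
  the bottom row by \<open>b\<close> gives labels that are constant on each block.
\<close>

definition row_label :: "nat list \<Rightarrow> nat list \<Rightarrow> nat list \<Rightarrow> vertex \<Rightarrow> nat" where
  "row_label a b c v = (case v of Top i \<Rightarrow> a ! (i - 1) | Mid i \<Rightarrow> b ! (i - 1) | Bot i \<Rightarrow> c ! (i - 1))"

definition const_on_blocks :: "(vertex \<Rightarrow> nat) \<Rightarrow> vertex set set \<Rightarrow> bool" where
  "const_on_blocks f P \<longleftrightarrow> (\<forall>B\<in>P. \<forall>u\<in>B. \<forall>v\<in>B. f u = f v)"

definition compatible :: "diagram \<Rightarrow> nat list \<Rightarrow> nat list \<Rightarrow> bool" where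
  "compatible P a c \<longleftrightarrow> const_on_blocks (row_label a [] c) P"

definition index_words :: "nat \<Rightarrow> nat \<Rightarrow> nat list set" where
  "index_words n r = {js. length js = r \<and> set js \<subseteq> {1..n}}"

lemma finite_words: "finite (index_words n r)"
  unfolding index_words_def using finite_lists_length_eq[of "{1..n}" r]
  by (simp add: conj_commute)

lemma Union_stacked:
  assumes "P \<in> diagrams r" "Q \<in> diagrams r"
  shows "\<Union>(stacked_blocks P Q) = Top ` {1..r} \<union> Mid ` {1..r} \<union> Bot ` {1..r}"
proof -
  have P: "\<Union>P = vertices r" and Q: "\<Union>Q = vertices r"
    using assms by (auto simp: diagrams_def partition_on_def)
  have "\<Union>(stacked_blocks P Q) = to_upper ` \<Union>P \<union> to_lower ` \<Union>Q"
    by (auto simp: stacked_blocks_def)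
  also have "\<dots> = to_upper ` vertices r \<union> to_lower ` vertices r"
    by (simp only: P Q)
  also have "\<dots> = Top ` {1..r} \<union> Mid ` {1..r} \<union> Bot ` {1..r}"
    by (auto simp: vertices_def image_Un image_image)
  finally show ?thesis .
qed

lemma equiv_stacked:
  "equiv (\<Union>(stacked_blocks P Q)) ((stacked_edges P Q)\<^sup>+)"
proof (rule equivI)
  have sub: "stacked_edges P Q \<subseteq> \<Union>(stacked_blocks P Q) \<times> \<Union>(stacked_blocks P Q)"
    by (auto simp: stacked_edges_def)
  show "(stacked_edges P Q)\<^sup>+ \<subseteq> \<Union>(stacked_blocks P Q) \<times> \<Union>(stacked_blocks P Q)"
    by (rule trancl_subset_Sigma[OF sub])
  show "refl_on (\<Union>(stacked_blocks P Q)) ((stacked_edges P Q)\<^sup>+)"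
    by (auto simp: refl_on_def stacked_edges_def intro!: r_into_trancl)
  show "sym ((stacked_edges P Q)\<^sup>+)"
    by (rule sym_trancl) (auto simp: sym_def stacked_edges_def)
  show "trans ((stacked_edges P Q)\<^sup>+)" by (rule trans_trancl)
qed

lemma const_stacked_components:
  "const_on_blocks f (stacked_blocks P Q) \<longleftrightarrow> const_on_blocks f (stacked_components P Q)"
proof
  assume a: "const_on_blocks f (stacked_blocks P Q)"
  have e: "f u = f v" if "(u, v) \<in> (stacked_edges P Q)\<^sup>+" for u v
    using that
  proof induction
    case (base y)
    then show ?case using a by (auto simp: const_on_blocks_def stacked_edges_def)
  next
    case (step y z)
    then show ?case using a by (fastforce simp: const_on_blocks_def stacked_edges_def)
  qed
  show "const_on_blocks f (stacked_components P Q)"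
    unfolding const_on_blocks_def stacked_components_def
    using quotient_eq_iff[OF equiv_stacked[of P Q]] e by (metis (no_types, lifting))
next
  assume a: "const_on_blocks f (stacked_components P Q)"
  show "const_on_blocks f (stacked_blocks P Q)"
    unfolding const_on_blocks_def
  proof safe
    fix B u v assume B: "B \<in> stacked_blocks P Q" "u \<in> B" "v \<in> B"
    have uv: "(u, v) \<in> (stacked_edges P Q)\<^sup>+" "(u,u) \<in> (stacked_edges P Q)\<^sup>+"
      using B by (auto simp: stacked_edges_def intro!: r_into_trancl)
    have "(stacked_edges P Q)\<^sup>+ `` {u} \<in> stacked_components P Q"
      unfolding stacked_components_def using B by (auto intro!: quotientI)
    moreover have "u \<in> (stacked_edges P Q)\<^sup>+ `` {u}" "v \<in> (stacked_edges P Q)\<^sup>+ `` {u}"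
      using uv by (simp_all only: Image_singleton_iff)
    ultimately show "f u = f v" using a unfolding const_on_blocks_def by (metis (no_types))
  qed
qed

lemma compatible_stacked:
  assumes "P \<in> diagrams r" "Q \<in> diagrams r"
  shows "compatible P a b \<and> compatible Q b c \<longleftrightarrow>
    const_on_blocks (row_label a b c) (stacked_components P Q)"
proof -
  have P: "\<Union>P = vertices r" and Q: "\<Union>Q = vertices r"
    using assms by (auto simp: diagrams_def partition_on_def)
  have 1: "row_label a b c (to_upper v) = row_label a [] b v" if "v \<in> vertices r" for v
    using that by (auto simp: vertices_def row_label_def)
  have 2: "row_label a b c (to_lower v) = row_label b [] c v" if "v \<in> vertices r" for v
    using that by (auto simp: vertices_def row_label_def)
  have "const_on_blocks (row_label a b c) (stacked_blocks P Q) \<longleftrightarrow>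
      (\<forall>B\<in>P. \<forall>u\<in>B. \<forall>v\<in>B. row_label a b c (to_upper u) = row_label a b c (to_upper v)) \<and>
      (\<forall>B\<in>Q. \<forall>u\<in>B. \<forall>v\<in>B. row_label a b c (to_lower u) = row_label a b c (to_lower v))"
    by (simp add: const_on_blocks_def stacked_blocks_def ball_Un)
  also have "\<dots> \<longleftrightarrow> compatible P a b \<and> compatible Q b c"
  proof -
    have "(\<forall>B\<in>P. \<forall>u\<in>B. \<forall>v\<in>B. row_label a b c (to_upper u) = row_label a b c (to_upper v))
        \<longleftrightarrow> compatible P a b"
      unfolding compatible_def const_on_blocks_def using P 1
      by (intro ball_cong refl) (metis UnionI)
    moreover have "(\<forall>B\<in>Q. \<forall>u\<in>B. \<forall>v\<in>B. row_label a b c (to_lower u) = row_label a b c (to_lower v))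
        \<longleftrightarrow> compatible Q b c"
      unfolding compatible_def const_on_blocks_def using Q 2
      by (intro ball_cong refl) (metis UnionI)
    ultimately show ?thesis by simp
  qed
  finally show ?thesis by (simp add: const_stacked_components)
qed

lemma compatible_comp:
  "compatible (diagram_comp P Q) a c \<longleftrightarrow>
    (\<forall>C\<in>stacked_components P Q. \<forall>u\<in>C - range Mid. \<forall>v\<in>C - range Mid.
      row_label a [] c u = row_label a [] c v)"
proof -
  have 1: "(\<forall>B\<in>X - {{}}. \<forall>u\<in>B. R B u) \<longleftrightarrow> (\<forall>B\<in>X. \<forall>u\<in>B. R B u)"
    for X :: "vertex set set" and R
    by blast
  show ?thesis
    unfolding compatible_def const_on_blocks_def diagram_comp_def 1 ball_simps(9) ..
qed

lemma card_middle_words: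
  assumes P: "P \<in> diagrams r" and Q: "Q \<in> diagrams r"
    and a: "a \<in> index_words n r" and c: "c \<in> index_words n r"
  shows "card {b \<in> index_words n r. compatible P a b \<and> compatible Q b c} =
    n ^ deleted_components P Q * of_bool (compatible (diagram_comp P Q) a c)"
proof (cases "compatible (diagram_comp P Q) a c")
  case False
  have "\<not> (compatible P a b \<and> compatible Q b c)" for b
  proof
    assume "compatible P a b \<and> compatible Q b c"
    hence k: "const_on_blocks (row_label a b c) (stacked_components P Q)"
      by (simp add: compatible_stacked[OF P Q])
    have "row_label a b c u = row_label a [] c u" if "u \<notin> range Mid" for u
      using that by (cases u) (auto simp: row_label_def)
    with k have "compatible (diagram_comp P Q) a c"
      unfolding compatible_comp const_on_blocks_def by (metis DiffE)
    with False show False by simp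
  qed
  hence "{b \<in> index_words n r. compatible P a b \<and> compatible Q b c} = {}" by blast
  with False show ?thesis by (simp only: card.empty of_bool_eq mult_0_right)
next
  case True
  define K where "K = stacked_components P Q"
  define D where "D = {C \<in> K. C \<subseteq> range Mid}"
  define U where "U = Top ` {1..r} \<union> Mid ` {1..r} \<union> Bot ` {1..r}"
  have U: "\<Union>(stacked_blocks P Q) = U" unfolding U_def by (rule Union_stacked[OF P Q])
  have finU: "finite U" by (simp add: U_def)
  have part: "partition_on U K"
    unfolding K_def stacked_components_def U[symmetric]
    by (rule partition_on_quotient[OF equiv_stacked])
  have UK: "\<Union>K = U" and disj: "disjoint K" and ne: "{} \<notin> K"
    using part by (auto simp: partition_on_def)
  have finK: "finite K" using finU UK by (simp add: finite_UnionD)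
  have finD: "finite D" using finK by (simp add: D_def)
  define cl where "cl v = (THE C. C \<in> K \<and> v \<in> C)" for v
  have cl_eq: "cl v = C" if "C \<in> K" "v \<in> C" for v C
    unfolding cl_def using that disj
    by (intro the_equality) (auto simp: disjoint_def)
  have clK: "cl v \<in> K" and vcl: "v \<in> cl v" if "v \<in> U" for v
  proof -
    obtain C where "C \<in> K" "v \<in> C" using \<open>v \<in> U\<close> UK by blast
    with cl_eq show "cl v \<in> K" "v \<in> cl v" by auto
  qed
  define rep where "rep C = (SOME v. v \<in> C)" for C :: "vertex set"
  have rep: "rep C \<in> C" if "C \<in> K" for C
    unfolding rep_def using that ne by (metis ex_in_conv someI_ex)
  define out where "out C = (SOME v. v \<in> C - range Mid)" for C :: "vertex set"
  have out: "out C \<in> C - range Mid" if "C \<in> K" "C \<notin> D" for C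
  proof -
    have "\<exists>v. v \<in> C - range Mid" using that by (auto simp: D_def)
    thus ?thesis unfolding out_def by (rule someI_ex)
  qed
  have lab_outer: "row_label a b c u = row_label a [] c u" if "u \<notin> range Mid" for u b
    using that by (cases u) (auto simp: row_label_def)
  have lab_range: "row_label a b c u \<in> {1..n}" if "u \<in> U" "b \<in> index_words n r" for u b
  proof -
    have "x ! (i - 1) \<in> {1..n}" if "x \<in> index_words n r" "i \<in> {1..r}" for x i
    proof -
      have "x ! (i - 1) \<in> set x" using that by (auto simp: index_words_def)
      with that show ?thesis by (auto simp: index_words_def)
    qed
    with that a c show ?thesis by (auto simp: U_def row_label_def)
  qed
  define B where "B = {b \<in> index_words n r. compatible P a b \<and> compatible Q b c}"
  define g where "g f C = (if C \<in> D then f C else row_label a [] c (out C))"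
    for f :: "vertex set \<Rightarrow> nat" and C
  define mk where "mk f = map (\<lambda>i. g f (cl (Mid i))) [1..<Suc r]" for f
  have mk_lab: "row_label a (mk f) c u = g f (cl u)" if "u \<in> U" for f u
  proof (cases "u \<in> range Mid")
    case True
    with that obtain i where i: "u = Mid i" "i \<in> {1..r}" by (auto simp: U_def)
    have "[1..<Suc r] ! (i - 1) = i" "i - 1 < length [1..<Suc r]"
      using i(2) by (auto simp del: upt_Suc)
    hence "mk f ! (i - 1) = g f (cl (Mid i))" unfolding mk_def by (simp only: nth_map)
    then show ?thesis by (simp only: i(1) row_label_def vertex.case)
  next
    case False
    have C: "cl u \<in> K" "u \<in> cl u" using that by (auto intro: clK vcl)
    hence D: "cl u \<notin> D" using False by (auto simp: D_def)
    have "row_label a [] c u = row_label a [] c (out (cl u))"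
      using True C False out[OF C(1) D] unfolding compatible_comp K_def by blast
    with D lab_outer[OF False, of "mk f"] show ?thesis by (simp add: g_def)
  qed
  have mkB: "mk f \<in> B" if f: "f \<in> D \<rightarrow>\<^sub>E {1..n}" for f
  proof -
    have "mk f \<in> index_words n r"
    proof -
      have "g f (cl (Mid i)) \<in> {1..n}" if "i \<in> {1..r}" for i
      proof (cases "cl (Mid i) \<in> D")
        case True
        then show ?thesis using f by (auto simp: g_def)
      next
        case False
        have "cl (Mid i) \<in> K" using that by (intro clK) (auto simp: U_def)
        with out[OF this False] UK have "out (cl (Mid i)) \<in> U" "out (cl (Mid i)) \<notin> range Mid"
          by auto
        with lab_range[OF this(1) a] lab_outer[OF this(2), of a] False show ?thesis
          by (simp add: g_def)
      qed
      thus ?thesis by (auto simp: index_words_def mk_def simp del: upt_Suc)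
    qed
    moreover have "const_on_blocks (row_label a (mk f) c) K"
      unfolding const_on_blocks_def
    proof safe
      fix C u v assume h: "C \<in> K" "u \<in> C" "v \<in> C"
      hence "u \<in> U" "v \<in> U" using UK by auto
      with h show "row_label a (mk f) c u = row_label a (mk f) c v"
        by (simp add: mk_lab cl_eq)
    qed
    ultimately show ?thesis
      unfolding B_def using compatible_stacked[OF P Q, of a "mk f" c] by (simp add: K_def)
  qed
  define ex where "ex b = restrict (\<lambda>C. row_label a b c (rep C)) D" for b
  have exB: "ex b \<in> D \<rightarrow>\<^sub>E {1..n}" if "b \<in> B" for b
  proof -
    have "row_label a b c (rep C) \<in> {1..n}" if "C \<in> D" for C
      using that \<open>b \<in> B\<close> rep[of C] UK by (intro lab_range) (auto simp: D_def B_def)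
    thus ?thesis by (auto simp: ex_def)
  qed
  have ex_mk: "ex (mk f) = f" if f: "f \<in> D \<rightarrow>\<^sub>E {1..n}" for f
  proof
    fix C
    show "ex (mk f) C = f C"
    proof (cases "C \<in> D")
      case True
      hence K: "C \<in> K" by (simp add: D_def)
      have "rep C \<in> U" using rep[OF K] K UK by auto
      with True rep[OF K] K show ?thesis by (simp add: ex_def mk_lab cl_eq g_def)
    next
      case False
      with f show ?thesis by (auto simp: ex_def PiE_def extensional_def)
    qed
  qed
  have mk_ex: "mk (ex b) = b" if b: "b \<in> B" for b
  proof (rule nth_equalityI)
    have len: "length b = r" using b by (auto simp: B_def index_words_def)
    show "length (mk (ex b)) = length b" by (simp add: mk_def len)
    fix m assume "m < length (mk (ex b))"
    hence m: "m < r" by (simp add: mk_def del: upt_Suc)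
    hence u: "Mid (Suc m) \<in> U" by (auto simp: U_def)
    let ?C = "cl (Mid (Suc m))"
    have C: "?C \<in> K" "Mid (Suc m) \<in> ?C" using u by (auto intro: clK vcl)
    have const: "row_label a b c v = row_label a b c (Mid (Suc m))" if "v \<in> ?C" for v
    proof -
      have "const_on_blocks (row_label a b c) K"
        using b compatible_stacked[OF P Q, of a b c] by (simp add: B_def K_def)
      from this[unfolded const_on_blocks_def, rule_format, OF C(1) that C(2)] show ?thesis .
    qed
    have "mk (ex b) ! m = row_label a (mk (ex b)) c (Mid (Suc m))" by (simp add: row_label_def)
    also have "\<dots> = g (ex b) ?C" by (rule mk_lab[OF u])
    also have "\<dots> = row_label a b c (Mid (Suc m))"
    proof (cases "?C \<in> D")
      case True
      then show ?thesis using const[OF rep[OF C(1)]] by (simp add: g_def ex_def)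
    next
      case False
      have o: "out ?C \<in> ?C" "out ?C \<notin> range Mid" using out[OF C(1) False] by auto
      show ?thesis using const[OF o(1)] False lab_outer[OF o(2), of b] by (simp add: g_def)
    qed
    also have "\<dots> = b ! m" by (simp add: row_label_def)
    finally show "mk (ex b) ! m = b ! m" .
  qed
  have "bij_betw ex B (D \<rightarrow>\<^sub>E {1..n})"
    by (rule bij_betwI[where g = mk]) (use exB mkB ex_mk mk_ex in auto)
  hence "card B = card (D \<rightarrow>\<^sub>E {1..n})" by (rule bij_betw_same_card)
  also have "\<dots> = n ^ card D" using finD by (simp add: card_PiE)
  finally show ?thesis using True by (simp add: B_def D_def K_def deleted_components_def)
qed


definition word_matrix :: "(diagram \<Rightarrow>\<^sub>0 complex) \<Rightarrow> nat list \<Rightarrow> nat list \<Rightarrow> complex" where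
  "word_matrix x a b = (\<Sum>P\<in>Poly_Mapping.keys x. Poly_Mapping.lookup x P * of_bool (compatible P a b))"

definition word_op ::
  "nat \<Rightarrow> nat \<Rightarrow> (diagram \<Rightarrow>\<^sub>0 complex) \<Rightarrow> (nat list \<Rightarrow>\<^sub>0 complex) \<Rightarrow> (nat list \<Rightarrow>\<^sub>0 complex)" where
  "word_op n r x t = (\<Sum>a\<in>index_words n r. \<Sum>b\<in>index_words n r.
     Poly_Mapping.single a (word_matrix x a b * Poly_Mapping.lookup t b))"

lemma lookup_word_op:
  "Poly_Mapping.lookup (word_op n r x t) a =
     (if a \<in> index_words n r then \<Sum>b\<in>index_words n r. word_matrix x a b * Poly_Mapping.lookup t b else 0)"
proof -
  have "Poly_Mapping.lookup (word_op n r x t) a =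
      (\<Sum>a'\<in>index_words n r. if a' = a then \<Sum>b\<in>index_words n r. word_matrix x a' b * Poly_Mapping.lookup t b else 0)"
    unfolding word_op_def lookup_sum
    by (intro sum.cong refl) (auto simp: lookup_single)
  thus ?thesis using finite_words by simp
qed

lemma lookup_scale: "Poly_Mapping.lookup (pm_scale c x) k = c * Poly_Mapping.lookup x k"
  by (simp add: pm_scale_def Poly_Mapping.map.rep_eq when_def)

lemma mat_superset:
  assumes "finite S" "Poly_Mapping.keys x \<subseteq> S"
  shows "word_matrix x a b = (\<Sum>P\<in>S. Poly_Mapping.lookup x P * of_bool (compatible P a b))"
  unfolding word_matrix_def using assms
  by (intro sum.mono_neutral_left) (auto simp: in_keys_iff)

lemma mat_add: "word_matrix (x + y) a b = word_matrix x a b + word_matrix y a b"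
proof -
  let ?S = "Poly_Mapping.keys x \<union> Poly_Mapping.keys y"
  have "Poly_Mapping.keys (x + y) \<subseteq> ?S" by (rule Poly_Mapping.keys_add)
  thus ?thesis
    by (simp add: mat_superset[of ?S] lookup_add distrib_right sum.distrib)
qed

lemma mat_zero: "word_matrix 0 a b = 0" by (simp add: word_matrix_def)

lemma mat_sum: "word_matrix (sum f A) a b = (\<Sum>i\<in>A. word_matrix (f i) a b)"
  by (induction A rule: infinite_finite_induct) (simp_all add: mat_zero mat_add)

lemma mat_scale: "word_matrix (pm_scale c x) a b = c * word_matrix x a b"
proof -
  have "Poly_Mapping.keys (pm_scale c x) \<subseteq> Poly_Mapping.keys x"
    by (auto simp: in_keys_iff lookup_scale)
  thus ?thesis
    by (simp add: mat_superset[of "Poly_Mapping.keys x"] lookup_scale sum_distrib_left mult.assoc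
          del: sum_mult_of_bool_eq)
qed

lemma mat_single: "word_matrix (Poly_Mapping.single P k) a b = k * of_bool (compatible P a b)"
  by (simp add: mat_superset[of "{P}"])

lemma mat_mult:
  assumes "x \<in> partition_algebra r" "y \<in> partition_algebra r" "a \<in> index_words n r" "c \<in> index_words n r"
  shows "word_matrix (pa_mult (of_nat n) x y) a c = (\<Sum>b\<in>index_words n r. word_matrix x a b * word_matrix y b c)"
proof -
  let ?l = Poly_Mapping.lookup
  have "word_matrix (pa_mult (of_nat n) x y) a c =
     (\<Sum>P\<in>Poly_Mapping.keys x. \<Sum>Q\<in>Poly_Mapping.keys y. ?l x P * ?l y Q *
        of_nat (n ^ deleted_components P Q * of_bool (compatible (diagram_comp P Q) a c)))"
    unfolding pa_mult_def mat_sum mat_single by (simp add: mult_ac)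
  also have "\<dots> = (\<Sum>P\<in>Poly_Mapping.keys x. \<Sum>Q\<in>Poly_Mapping.keys y. ?l x P * ?l y Q *
        of_nat (card {b \<in> index_words n r. compatible P a b \<and> compatible Q b c}))"
    using assms
    by (intro sum.cong refl) (subst card_middle_words[where r = r], auto simp: partition_algebra_def)
  also have "\<dots> = (\<Sum>P\<in>Poly_Mapping.keys x. \<Sum>Q\<in>Poly_Mapping.keys y. \<Sum>b\<in>index_words n r.
        (?l x P * of_bool (compatible P a b)) * (?l y Q * of_bool (compatible Q b c)))"
  proof (intro sum.cong refl)
    fix P Q
    have "of_nat (card {b \<in> index_words n r. compatible P a b \<and> compatible Q b c}) =
        (\<Sum>b\<in>index_words n r. of_bool (compatible P a b \<and> compatible Q b c) :: complex)"
      using finite_words[of n r] by (simp add: sum.If_cases of_bool_def Int_def)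
    thus "?l x P * ?l y Q * of_nat (card {b \<in> index_words n r. compatible P a b \<and> compatible Q b c}) =
      (\<Sum>b\<in>index_words n r. (?l x P * of_bool (compatible P a b)) * (?l y Q * of_bool (compatible Q b c)))"
      by (simp add: sum_distrib_left of_bool_conj mult_ac)
  qed
  also have "\<dots> = (\<Sum>P\<in>Poly_Mapping.keys x. \<Sum>b\<in>index_words n r. \<Sum>Q\<in>Poly_Mapping.keys y.
        (?l x P * of_bool (compatible P a b)) * (?l y Q * of_bool (compatible Q b c)))"
    by (intro sum.cong refl sum.swap)
  also have "\<dots> = (\<Sum>b\<in>index_words n r. word_matrix x a b * word_matrix y b c)"
    unfolding word_matrix_def sum_product by (rule sum.swap)
  finally show ?thesis .
qed

lemma word_op_mult:
  assumes "x \<in> partition_algebra r" "y \<in> partition_algebra r"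
  shows "word_op n r (pa_mult (of_nat n) x y) t = word_op n r x (word_op n r y t)"
proof (rule poly_mapping_eqI)
  fix a
  show "Poly_Mapping.lookup (word_op n r (pa_mult (of_nat n) x y) t) a =
    Poly_Mapping.lookup (word_op n r x (word_op n r y t)) a"
  proof (cases "a \<in> index_words n r")
    case True
    have "(\<Sum>c\<in>index_words n r. word_matrix (pa_mult (of_nat n) x y) a c * Poly_Mapping.lookup t c) =
      (\<Sum>c\<in>index_words n r. \<Sum>b\<in>index_words n r. word_matrix x a b * (word_matrix y b c * Poly_Mapping.lookup t c))"
      using True by (intro sum.cong refl) (simp add: mat_mult[OF assms] sum_distrib_right mult.assoc)
    also have "\<dots> = (\<Sum>b\<in>index_words n r. word_matrix x a b * (\<Sum>c\<in>index_words n r. word_matrix y b c * Poly_Mapping.lookup t c))"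
      by (subst sum.swap) (simp add: sum_distrib_left)
    finally show ?thesis using True by (simp add: lookup_word_op)
  qed (simp add: lookup_word_op)
qed

lemma lookup_tensor_prod:
  "Poly_Mapping.lookup (tensor_prod r w) js =
    (if length js = r then \<Prod>l=1..r. Poly_Mapping.lookup (w l) (js ! (l - 1)) else 0)"
proof (induction r arbitrary: js)
  case 0
  then show ?case by (cases js) (simp_all add: lookup_single when_def)
next
  case (Suc r)
  let ?l = Poly_Mapping.lookup and ?k = Poly_Mapping.keys
  have e: "?l (tensor_prod (Suc r) w) js =
    (\<Sum>is\<in>?k (tensor_prod r w). \<Sum>j\<in>?k (w (Suc r)). (?l (tensor_prod r w) is * ?l (w (Suc r)) j when is @ [j] = js))"
    by (simp add: lookup_sum lookup_single)
  show ?case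
  proof (cases js rule: rev_cases)
    case Nil
    show ?thesis unfolding e by (simp only: Nil when_def) simp
  next
    case (snoc ks m)
    have "?l (tensor_prod (Suc r) w) js = (\<Sum>is\<in>?k (tensor_prod r w). if is = ks then
        (\<Sum>j\<in>?k (w (Suc r)). if j = m then ?l (tensor_prod r w) is * ?l (w (Suc r)) j else 0) else 0)"
      unfolding e unfolding snoc by (intro sum.cong refl) (auto simp: when_def intro: sum.cong)
    also have "\<dots> = ?l (tensor_prod r w) ks * ?l (w (Suc r)) m"
      by (simp add: in_keys_iff)
    also have "\<dots> = (if length js = Suc r then
        (\<Prod>l=1..r. ?l (w l) (js ! (l - 1))) * ?l (w (Suc r)) (js ! r) else 0)"
      by (auto simp: Suc.IH snoc nth_append intro!: prod.cong)
    also have "\<dots> = (if length js = Suc r then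
        (\<Prod>l=1..Suc r. ?l (w l) (js ! (l - 1))) else 0)"
      by simp
    finally show ?thesis .
  qed
qed

definition index_word :: "nat \<Rightarrow> (nat \<Rightarrow> nat) \<Rightarrow> nat list" where
  "index_word r i = map i [1..<Suc r]"

lemma word_nth: "l \<in> {1..r} \<Longrightarrow> index_word r i ! (l - 1) = i l"
  by (auto simp: index_word_def simp del: upt_Suc)

lemma length_word [simp]: "length (index_word r i) = r"
  by (simp add: index_word_def)

lemma word_in_words: "\<forall>l\<in>{1..r}. i l \<in> {1..n} \<Longrightarrow> index_word r i \<in> index_words n r"
  by (auto simp: index_words_def index_word_def simp del: upt_Suc)

lemma list_eq_1:
  "length xs = r \<Longrightarrow> length ys = r \<Longrightarrow> xs = ys \<longleftrightarrow> (\<forall>l\<in>{1..r}. xs ! (l - 1) = ys ! (l - 1))"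
proof (intro iffI ballI)
  assume h: "length xs = r" "length ys = r" "\<forall>l\<in>{1..r}. xs ! (l - 1) = ys ! (l - 1)"
  show "xs = ys"
  proof (rule nth_equalityI)
    fix i assume "i < length xs"
    thus "xs ! i = ys ! i" using h(1) h(3)[rule_format, of "Suc i"] by simp
  qed (use h in simp)
qed simp

lemma tensor_prod_basis: "tensor_prod r (\<lambda>l. basis_vec (i l)) = Poly_Mapping.single (index_word r i) 1"
proof (rule poly_mapping_eqI)
  fix js
  show "Poly_Mapping.lookup (tensor_prod r (\<lambda>l. basis_vec (i l))) js =
    Poly_Mapping.lookup (Poly_Mapping.single (index_word r i) 1) js"
  proof (cases "length js = r")
    case True
    have "(\<Prod>l=1..r. Poly_Mapping.lookup (basis_vec (i l)) (js ! (l - 1))) =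
       (\<Prod>l=1..r. of_bool (index_word r i ! (l - 1) = js ! (l - 1)))"
      by (intro prod.cong refl) (simp only: word_nth, simp add: basis_vec_def lookup_single when_def)
    also have "\<dots> = of_bool (\<forall>l\<in>{1..r}. index_word r i ! (l - 1) = js ! (l - 1))"
      by (cases "\<forall>l\<in>{1..r}. index_word r i ! (l - 1) = js ! (l - 1)") (auto intro: prod_zero)
    finally show ?thesis
      using True by (simp add: lookup_tensor_prod lookup_single when_def list_eq_1[of "index_word r i" r js])
  next
    case False
    then show ?thesis by (auto simp: lookup_tensor_prod lookup_single when_def)
  qed
qed

lemma compatible_through:
  "const_on_blocks (row_label a [] b) (through_blocks r X) \<longleftrightarrow>
    (\<forall>l\<in>{1..r} - X. a ! (l - 1) = b ! (l - 1))"
  by (auto simp: const_on_blocks_def through_blocks_def row_label_def)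

lemma const_on_blocks_Un:
  "const_on_blocks f (P \<union> Q) \<longleftrightarrow> const_on_blocks f P \<and> const_on_blocks f Q"
  by (auto simp: const_on_blocks_def)

lemma compatible_id:
  "length a = r \<Longrightarrow> length b = r \<Longrightarrow> compatible (id_diagram r) a b \<longleftrightarrow> a = b"
  by (simp add: compatible_def id_diagram_def compatible_through list_eq_1[of a r b])

lemma compatible_p:
  "compatible (p_diagram r m) a b \<longleftrightarrow> (\<forall>l\<in>{1..r} - {m}. a ! (l - 1) = b ! (l - 1))"
proof -
  have "const_on_blocks (row_label a [] b) {{Top m}, {Bot m}}"
    by (auto simp: const_on_blocks_def)
  thus ?thesis
    by (simp add: compatible_def p_diagram_def const_on_blocks_Un compatible_through del: Un_insert_left)
qed

lemma compatible_s:
  assumes "1 \<le> m" "m < r"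
  shows "compatible (s_diagram r m) a b \<longleftrightarrow>
    (\<forall>l\<in>{1..r}. a ! (l - 1) = b ! (transpose m (m + 1) l - 1))"
proof -
  have 1: "const_on_blocks (row_label a [] b) {{Top m, Bot (m + 1)}, {Top (m + 1), Bot m}} \<longleftrightarrow>
     a ! (m - 1) = b ! m \<and> a ! m = b ! (m - 1)"
    by (auto simp: const_on_blocks_def row_label_def)
  have 2: "{1..r} = insert m (insert (m + 1) ({1..r} - {m, m + 1}))" using assms by auto
  have 3: "(\<forall>l\<in>{1..r}. a ! (l - 1) = b ! (transpose m (m + 1) l - 1)) \<longleftrightarrow>
     (a ! (m - 1) = b ! m \<and> a ! m = b ! (m - 1)) \<and> (\<forall>l\<in>{1..r} - {m, m + 1}. a ! (l - 1) = b ! (l - 1))"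
    by (subst 2) (simp add: transpose_def)
  show ?thesis
    unfolding compatible_def s_diagram_def const_on_blocks_Un compatible_through 1 3 ..
qed

lemma compatible_ph:
  assumes "1 \<le> m" "m < r" "length a = r" "length b = r"
  shows "compatible (p_half_diagram r m) a b \<longleftrightarrow> a = b \<and> b ! (m - 1) = b ! m"
proof -
  have 1: "const_on_blocks (row_label a [] b) {{Top m, Top (m + 1), Bot m, Bot (m + 1)}} \<longleftrightarrow>
     a ! (m - 1) = b ! (m - 1) \<and> a ! m = b ! m \<and> b ! (m - 1) = b ! m"
    by (auto simp: const_on_blocks_def row_label_def)
  have 2: "{1..r} = insert m (insert (m + 1) ({1..r} - {m, m + 1}))" using assms by auto
  have 3: "a = b \<longleftrightarrow> a ! (m - 1) = b ! (m - 1) \<and> a ! m = b ! m \<and>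
     (\<forall>l\<in>{1..r} - {m, m + 1}. a ! (l - 1) = b ! (l - 1))"
    unfolding list_eq_1[OF assms(3,4)] by (subst 2) simp
  show ?thesis
    unfolding compatible_def p_half_diagram_def const_on_blocks_Un compatible_through 1 3 by blast
qed

lemma lookup_word_op_basis:
  assumes "b \<in> index_words n r"
  shows "Poly_Mapping.lookup (word_op n r (pa_basis P) (Poly_Mapping.single b 1)) a =
    of_bool (a \<in> index_words n r \<and> compatible P a b)"
proof -
  have "(\<Sum>b'\<in>index_words n r. word_matrix (pa_basis P) a b' * Poly_Mapping.lookup (Poly_Mapping.single b 1) b') =
     (\<Sum>b'\<in>index_words n r. if b' = b then word_matrix (pa_basis P) a b' else 0)"
    by (intro sum.cong refl) (auto simp: lookup_single when_def)
  with assms finite_words[of n r] show ?thesis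
    by (simp add: lookup_word_op pa_basis_def mat_single)
qed

lemma words_nth: "a \<in> index_words n r \<longleftrightarrow> length a = r \<and> (\<forall>l\<in>{1..r}. a ! (l - 1) \<in> {1..n})"
proof -
  have "set a = (\<lambda>l. a ! (l - 1)) ` {1..r}" if "length a = r"
  proof -
    have "{1..r} = Suc ` {0..<r}" by (simp add: image_Suc_atLeastLessThan atLeastLessThanSuc_atLeastAtMost)
    hence "(\<lambda>l. a ! (l - 1)) ` {1..r} = (\<lambda>l. a ! l) ` {0..<r}"
      by (simp only: image_image diff_Suc_1)
    thus ?thesis using that nth_image[of r a] by (simp add: atLeast0LessThan)
  qed
  thus ?thesis unfolding index_words_def by fastforce
qed

lemma word_op_id:
  assumes "t \<in> tensor_space n r"
  shows "word_op n r (pa_basis (id_diagram r)) t = t"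
proof (rule poly_mapping_eqI)
  fix a
  show "Poly_Mapping.lookup (word_op n r (pa_basis (id_diagram r)) t) a = Poly_Mapping.lookup t a"
  proof (cases "a \<in> index_words n r")
    case True
    have "(\<Sum>b\<in>index_words n r. word_matrix (pa_basis (id_diagram r)) a b * Poly_Mapping.lookup t b) =
      (\<Sum>b\<in>index_words n r. if b = a then Poly_Mapping.lookup t b else 0)"
      using True by (intro sum.cong refl)
        (auto simp: pa_basis_def mat_single compatible_id[where r = r] index_words_def)
    with True finite_words[of n r] show ?thesis by (simp add: lookup_word_op)
  next
    case False
    with assms show ?thesis
      by (auto simp: lookup_word_op tensor_space_def index_words_def in_keys_iff subset_iff)
  qed
qed

lemma word_op_s:
  assumes "1 \<le> m" "m < r" "\<forall>l\<in>{1..r}. w l \<in> V_space n"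
  shows "word_op n r (pa_basis (s_diagram r m)) (tensor_prod r w) = tensor_prod r (w \<circ> transpose m (m + 1))"
proof (rule poly_mapping_eqI)
  fix a
  let ?\<tau> = "transpose m (m + 1)"
  have tau: "?\<tau> l \<in> {1..r}" if "l \<in> {1..r}" for l
    using that assms by (auto simp: transpose_def)
  have bij: "bij_betw ?\<tau> {1..r} {1..r}"
    by (rule bij_betwI[where g = ?\<tau>]) (use tau in auto)
  show "Poly_Mapping.lookup (word_op n r (pa_basis (s_diagram r m)) (tensor_prod r w)) a =
    Poly_Mapping.lookup (tensor_prod r (w \<circ> ?\<tau>)) a"
  proof (cases "a \<in> index_words n r")
    case True
    define c where "c = index_word r (\<lambda>l. a ! (?\<tau> l - 1))"
    have c: "c \<in> index_words n r"
      unfolding c_def using True tau by (intro word_in_words) (auto simp: words_nth)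
    have cn: "c ! (l - 1) = a ! (?\<tau> l - 1)" if "l \<in> {1..r}" for l
      using that by (simp only: c_def word_nth)
    have comp: "compatible (s_diagram r m) a b \<longleftrightarrow> b = c" if b: "b \<in> index_words n r" for b
    proof -
      have lb: "length b = r" "length c = r" using b c by (auto simp: index_words_def)
      have "b = c \<longleftrightarrow> (\<forall>l\<in>{1..r}. b ! (l - 1) = a ! (?\<tau> l - 1))"
        unfolding list_eq_1[OF lb] using cn by auto
      also have "\<dots> \<longleftrightarrow> (\<forall>l\<in>{1..r}. b ! (?\<tau> l - 1) = a ! (l - 1))"
      proof safe
      fix l assume "\<forall>l\<in>{1..r}. b ! (l - 1) = a ! (?\<tau> l - 1)" and l: "l \<in> {1..r}"
      from bspec[OF this(1) tau[OF l]] show "b ! (?\<tau> l - 1) = a ! (l - 1)"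
        by (simp only: transpose_involutory)
    next
      fix l assume "\<forall>l\<in>{1..r}. b ! (?\<tau> l - 1) = a ! (l - 1)" and l: "l \<in> {1..r}"
      from bspec[OF this(1) tau[OF l]] show "b ! (l - 1) = a ! (?\<tau> l - 1)"
        by (simp only: transpose_involutory)
    qed
      finally show ?thesis unfolding compatible_s[OF assms(1,2)] by auto
    qed
    have "(\<Sum>b\<in>index_words n r. word_matrix (pa_basis (s_diagram r m)) a b * Poly_Mapping.lookup (tensor_prod r w) b) =
      (\<Sum>b\<in>index_words n r. if b = c then Poly_Mapping.lookup (tensor_prod r w) b else 0)"
      by (intro sum.cong refl) (auto simp: pa_basis_def mat_single comp)
    also have "\<dots> = Poly_Mapping.lookup (tensor_prod r w) c"
      using c finite_words[of n r] by simp
    also have "\<dots> = (\<Prod>l\<in>{1..r}. Poly_Mapping.lookup (w l) (a ! (?\<tau> l - 1)))"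
      using cn by (simp add: lookup_tensor_prod c_def[THEN arg_cong[of _ _ length]])
    also have "\<dots> = (\<Prod>l\<in>{1..r}. Poly_Mapping.lookup (w (?\<tau> l)) (a ! (?\<tau> (?\<tau> l) - 1)))"
      by (rule prod.reindex_bij_betw[OF bij, symmetric])
    also have "\<dots> = Poly_Mapping.lookup (tensor_prod r (w \<circ> ?\<tau>)) a"
      using True by (simp add: lookup_tensor_prod index_words_def)
    finally show ?thesis using True by (simp add: lookup_word_op)
  next
    case False
    have "Poly_Mapping.lookup (tensor_prod r (w \<circ> ?\<tau>)) a = 0"
    proof (cases "length a = r")
      case True
      with False obtain l where l: "l \<in> {1..r}" "a ! (l - 1) \<notin> {1..n}" by (auto simp: words_nth)
      have "w (?\<tau> l) \<in> V_space n" using assms(3) tau[OF l(1)] by blast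
      with l have "Poly_Mapping.lookup ((w \<circ> ?\<tau>) l) (a ! (l - 1)) = 0"
        by (auto simp: V_space_def in_keys_iff subset_iff)
      with l(1) have "\<exists>l\<in>{1..r}. Poly_Mapping.lookup ((w \<circ> ?\<tau>) l) (a ! (l - 1)) = 0" by blast
      with True show ?thesis unfolding lookup_tensor_prod
        by (simp only: if_True refl) (rule prod_zero, simp_all)
    qed (simp add: lookup_tensor_prod)
    with False show ?thesis by (simp add: lookup_word_op)
  qed
qed

lemma word_op_ph:
  assumes "1 \<le> m" "m < r" "\<forall>l\<in>{1..r}. i l \<in> {1..n}"
  shows "word_op n r (pa_basis (p_half_diagram r m)) (tensor_prod r (\<lambda>l. basis_vec (i l))) =
    (if i m = i (m + 1) then tensor_prod r (\<lambda>l. basis_vec (i l)) else 0)"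
proof (rule poly_mapping_eqI)
  fix a
  let ?b = "index_word r i"
  have b: "?b \<in> index_words n r" using assms by (intro word_in_words)
  have "?b ! (m - 1) = i m" "?b ! m = i (m + 1)"
    using assms word_nth[of m r i] word_nth[of "m + 1" r i] by auto
  hence "(a \<in> index_words n r \<and> compatible (p_half_diagram r m) a ?b) \<longleftrightarrow> (a = ?b \<and> i m = i (m + 1))"
    using b compatible_ph[OF assms(1,2), of a ?b] by (auto simp: index_words_def)
  thus "Poly_Mapping.lookup (word_op n r (pa_basis (p_half_diagram r m)) (tensor_prod r (\<lambda>l. basis_vec (i l)))) a =
    Poly_Mapping.lookup (if i m = i (m + 1) then tensor_prod r (\<lambda>l. basis_vec (i l)) else 0) a"
    unfolding tensor_prod_basis lookup_word_op_basis[OF b] by (auto simp: lookup_single when_def)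
qed

lemma word_op_p:
  assumes "1 \<le> m" "m \<le> r" "\<forall>l\<in>{1..r}. i l \<in> {1..n}"
  shows "word_op n r (pa_basis (p_diagram r m)) (tensor_prod r (\<lambda>l. basis_vec (i l))) =
    (\<Sum>j=1..n. tensor_prod r (\<lambda>l. basis_vec ((i(m := j)) l)))"
proof (rule poly_mapping_eqI)
  fix a
  let ?b = "index_word r i"
  have b: "?b \<in> index_words n r" using assms by (intro word_in_words)
  have eq: "index_word r (i(m := j)) = a \<longleftrightarrow>
      length a = r \<and> j = a ! (m - 1) \<and> (\<forall>l\<in>{1..r} - {m}. a ! (l - 1) = ?b ! (l - 1))" for j
  proof (cases "length a = r")
    case True
    have 2: "{1..r} = insert m ({1..r} - {m})" using assms by auto
    have "index_word r (i(m := j)) = a \<longleftrightarrow> (\<forall>l\<in>{1..r}. (i(m := j)) l = a ! (l - 1))"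
      unfolding list_eq_1[OF length_word True] using word_nth by simp
    also have "\<dots> \<longleftrightarrow> j = a ! (m - 1) \<and> (\<forall>l\<in>{1..r} - {m}. i l = a ! (l - 1))"
      by (subst 2) auto
    also have "\<dots> \<longleftrightarrow> j = a ! (m - 1) \<and> (\<forall>l\<in>{1..r} - {m}. a ! (l - 1) = ?b ! (l - 1))"
    proof -
      have "i l = a ! (l - 1) \<longleftrightarrow> a ! (l - 1) = ?b ! (l - 1)" if "l \<in> {1..r} - {m}" for l
        using that word_nth[of l r i] by auto
      thus ?thesis by blast
    qed
    finally show ?thesis using True by simp
  qed auto
  let ?K = "length a = r \<and> (\<forall>l\<in>{1..r} - {m}. a ! (l - 1) = ?b ! (l - 1))"
  have "a \<in> index_words n r \<and> compatible (p_diagram r m) a ?b \<longleftrightarrow> a ! (m - 1) \<in> {1..n} \<and> ?K"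
  proof -
    have m: "m \<in> {1..r}" using assms by auto
    have range: "?b ! (l - 1) \<in> {1..n}" if "l \<in> {1..r}" for l
      using that assms(3) by (simp only: word_nth)
    have "a ! (l - 1) \<in> {1..n}"
      if h: "a ! (m - 1) \<in> {1..n}" "\<forall>l\<in>{1..r} - {m}. a ! (l - 1) = ?b ! (l - 1)"
        and l: "l \<in> {1..r}" for l
    proof (cases "l = m")
      case False
      hence "a ! (l - 1) = ?b ! (l - 1)" using h(2) l by blast
      with range[OF l] show ?thesis by (simp only:)
    qed (use h in simp)
    with m show ?thesis unfolding words_nth compatible_p by blast
  qed
  moreover have "Poly_Mapping.lookup (\<Sum>j=1..n. tensor_prod r (\<lambda>l. basis_vec ((i(m := j)) l))) a =
     of_bool (a ! (m - 1) \<in> {1..n} \<and> ?K)"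
  proof -
    have "Poly_Mapping.lookup (\<Sum>j=1..n. tensor_prod r (\<lambda>l. basis_vec ((i(m := j)) l))) a =
       (\<Sum>j=1..n. if j = a ! (m - 1) then of_bool ?K else 0)"
      unfolding tensor_prod_basis lookup_sum lookup_single eq when_def by (intro sum.cong refl) auto
    thus ?thesis by (simp only: sum.delta finite_atLeastAtMost) (simp only: of_bool_def split: if_split, blast)
  qed
  ultimately show "Poly_Mapping.lookup (word_op n r (pa_basis (p_diagram r m)) (tensor_prod r (\<lambda>l. basis_vec (i l)))) a =
    Poly_Mapping.lookup (\<Sum>j=1..n. tensor_prod r (\<lambda>l. basis_vec ((i(m := j)) l))) a"
    unfolding tensor_prod_basis[of r i] lookup_word_op_basis[OF b] by (simp only:)
qed

theorem tensor_action_exists: "tensor_action n r (word_op n r)"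
  unfolding tensor_action_def
proof (intro conjI ballI allI impI)
  fix x t u y c
  show "word_op n r x t \<in> tensor_space n r"
  proof -
    have "k \<in> index_words n r" if "k \<in> Poly_Mapping.keys (word_op n r x t)" for k
      using that unfolding in_keys_iff lookup_word_op by (auto split: if_splits)
    thus ?thesis unfolding tensor_space_def index_words_def by blast
  qed
  show "word_op n r x (t + u) = word_op n r x t + word_op n r x u"
    by (rule poly_mapping_eqI) (simp add: lookup_word_op lookup_add distrib_left sum.distrib)
  show "word_op n r x (pm_scale c t) = pm_scale c (word_op n r x t)"
    by (rule poly_mapping_eqI) (simp add: lookup_word_op lookup_scale sum_distrib_left mult_ac)
  show "word_op n r (x + y) t = word_op n r x t + word_op n r y t"
    by (rule poly_mapping_eqI) (simp add: lookup_word_op lookup_add mat_add distrib_right sum.distrib)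
  show "word_op n r (pm_scale c x) t = pm_scale c (word_op n r x t)"
    by (rule poly_mapping_eqI) (simp add: lookup_word_op lookup_scale mat_scale sum_distrib_left mult_ac)
qed (use word_op_id word_op_mult word_op_s word_op_ph word_op_p in auto)

end

theory Submission
  imports Defs
begin

text \<open>
  The two claims only become inductive once the action of \<open>L\<^sub>m\<close> is known as well.  For a basis word
  with letters \<open>f 1, f 2, \<dots>\<close> and \<open>a = f m\<close>, the element \<open>L\<^sub>m\<close> yields the sum over \<open>j = 1, \<dots>, n\<close> of the
  words in which \<open>s\<^bsub>a,j\<^esub>\<close> has been applied to each of the first \<open>m\<close> letters (so the \<open>m\<close>-th becomes \<open>j\<close>),
  which for \<open>m = 1\<close> is the action of \<open>p\<^sub>1\<close>.  In the sum for \<open>L\<^bsub>m+1\<^esub>\<close> the term with \<open>j = f m\<close> is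
  exactly the asserted action of \<open>\<sigma>\<^bsub>m+1\<^esub>\<close>, and the remaining terms are what the four other products
  in the recursion for \<open>L\<^bsub>m+1\<^esub>\<close> contribute.  So the formula for \<open>L\<^bsub>m+1\<^esub>\<close> follows from those for
  \<open>L\<^sub>m\<close> and \<open>\<sigma>\<^bsub>m+1\<^esub>\<close>, and the formula for \<open>\<sigma>\<^bsub>m+2\<^esub>\<close> from the same two: the statements are proved
  together by induction (\<open>L_step\<close>, \<open>sigma_step\<close>).  The formula for \<open>\<sigma>\<^bsub>m+1/2\<^esub>\<close> is then a second
  induction that uses the one for \<open>L\<^sub>m\<close> (\<open>sigma_half_step\<close>).

  In an induction step for \<open>\<sigma>\<close> let \<open>x, y, z\<close> be the letters at the positions \<open>m, m + 1, m + 2\<close>.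
  Every generator in the recursion touches only these three letters, while \<open>L\<^sub>m\<close> and \<open>\<sigma>\<^bsub>m+1\<^esub>\<close>
  moreover permute the values of the letters in front of them.  In the products containing \<open>L\<^sub>m\<close>, the
  half-integral generators leave either nothing or the single term in which this permutation is
  \<open>s\<^bsub>y,z\<^esub>\<close>; in the other product it is \<open>s\<^bsub>y,z\<^esub>\<close> because the \<open>s\<^sub>i\<close> bring \<open>y\<close> and \<open>z\<close> to the pivot.
  It remains to compare three letters.  The first product
  always gives \<open>x z y\<close> for \<open>\<sigma>\<^bsub>m+2\<^esub>\<close> (and \<open>x y z\<close> for \<open>\<sigma>\<^bsub>m+3/2\<^esub>\<close>), which is right unless \<open>x\<close> is one of
  \<open>y\<close> and \<open>z\<close>; each of the coincidences \<open>x = y\<close> and \<open>x = z\<close> brings in one positive product with the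
  correct word and one negative product that cancels the wrong one.

  The axioms of \<^const>\<open>tensor_action\<close> concern complex coefficients and hold on the carriers only.  So
  the action is pulled back along the evaluation of the indeterminate at \<open>n\<close>, which is
  multiplicative (\<open>specialize_mult\<close>), and all products have to stay in the span of the diagrams
  (\<open>partition_algebra_mult\<close>).
\<close>

section \<open>The partition algebra and its specialization\<close>

text \<open>
  The components of the stacked picture partition all three rows; deleting the middle row and
  discarding the components that become empty is the restriction of this partition to the two
  outer rows.
\<close>

lemma diagram_comp_closed:
  assumes "P \<in> diagrams r" "Q \<in> diagrams r"
  shows "diagram_comp P Q \<in> diagrams r"
proof -
  have "partition_on (\<Union>(stacked_blocks P Q)) (stacked_components P Q)"
    unfolding stacked_components_def by (rule partition_on_quotient[OF equiv_stacked])
  from partition_on_restrict[OF this, of "- range Mid"]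
  have "partition_on (- range Mid \<inter> \<Union>(stacked_blocks P Q))
      ((\<inter>) (- range Mid) ` stacked_components P Q - {{}})" .
  moreover have "- range Mid \<inter> \<Union>(stacked_blocks P Q) = vertices r"
    unfolding Union_stacked[OF assms] vertices_def by auto
  moreover have "(\<inter>) (- range Mid) ` stacked_components P Q = (\<lambda>C. C - range Mid) ` stacked_components P Q"
    by (rule image_cong) auto
  ultimately show ?thesis
    by (simp add: diagram_comp_def diagrams_def)
qed

text \<open>
  Specialization can kill coefficients and so shrink the supports over which the product is
  summed; the products of an element and of its image are comparable only over a common index set.
\<close>

lemma pa_mult_superset:
  assumes "finite S" "Poly_Mapping.keys x \<subseteq> S" "finite T" "Poly_Mapping.keys y \<subseteq> T"
  shows "pa_mult q x y = (\<Sum>P\<in>S. \<Sum>Q\<in>T. Poly_Mapping.single (diagram_comp P Q)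
      (q ^ deleted_components P Q * Poly_Mapping.lookup x P * Poly_Mapping.lookup y Q))"
proof -
  have "pa_mult q x y = (\<Sum>P\<in>Poly_Mapping.keys x. \<Sum>Q\<in>T. Poly_Mapping.single (diagram_comp P Q)
      (q ^ deleted_components P Q * Poly_Mapping.lookup x P * Poly_Mapping.lookup y Q))"
    unfolding pa_mult_def using assms
    by (intro sum.cong refl sum.mono_neutral_left) (auto simp: in_keys_iff)
  also have "\<dots> = (\<Sum>P\<in>S. \<Sum>Q\<in>T. Poly_Mapping.single (diagram_comp P Q)
      (q ^ deleted_components P Q * Poly_Mapping.lookup x P * Poly_Mapping.lookup y Q))"
    using assms by (intro sum.mono_neutral_left) (auto simp: in_keys_iff)
  finally show ?thesis .
qed

lemma partition_algebra_zero [simp]: "0 \<in> partition_algebra r"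
  by (simp add: partition_algebra_def)

lemma partition_algebra_add [simp]:
  "x \<in> partition_algebra r \<Longrightarrow> y \<in> partition_algebra r \<Longrightarrow> x + y \<in> partition_algebra r"
  unfolding partition_algebra_def using Poly_Mapping.keys_add[of x y] by blast

lemma partition_algebra_uminus [simp]:
  "x \<in> partition_algebra r \<Longrightarrow> - x \<in> partition_algebra r" for x :: "diagram \<Rightarrow>\<^sub>0 'a::ab_group_add"
  by (simp add: partition_algebra_def)

lemma partition_algebra_diff [simp]:
  "x \<in> partition_algebra r \<Longrightarrow> y \<in> partition_algebra r \<Longrightarrow> x - y \<in> partition_algebra r"
  for x :: "diagram \<Rightarrow>\<^sub>0 'a::ab_group_add"
  using partition_algebra_add[of x r "- y"] by simp

lemma partition_algebra_sum:
  "(\<And>i. i \<in> A \<Longrightarrow> f i \<in> partition_algebra r) \<Longrightarrow> sum f A \<in> partition_algebra r"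
  by (induction A rule: infinite_finite_induct) auto

lemma partition_algebra_single:
  "P \<in> diagrams r \<Longrightarrow> Poly_Mapping.single P c \<in> partition_algebra r"
  by (simp add: partition_algebra_def)

lemma partition_algebra_mult:
  "x \<in> partition_algebra r \<Longrightarrow> y \<in> partition_algebra r \<Longrightarrow> pa_mult q x y \<in> partition_algebra r"
  unfolding pa_mult_def
  by (intro partition_algebra_sum partition_algebra_single diagram_comp_closed)
     (auto simp: partition_algebra_def)

lemma partition_algebra_z_mult [simp]:
  "x \<in> partition_algebra r \<Longrightarrow> y \<in> partition_algebra r \<Longrightarrow> x \<star> y \<in> partition_algebra r"
  by (simp add: z_mult_def partition_algebra_mult)

lemma through_blocks_partition:
  "partition_on (vertices r - Top ` X - Bot ` X) (through_blocks r X)"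
  by (auto simp: partition_on_def disjoint_def through_blocks_def vertices_def)

lemma id_diagram_in [simp]: "pa_basis (id_diagram r) \<in> partition_algebra r"
  using through_blocks_partition[of r "{}"]
  by (simp add: pa_basis_def partition_algebra_single diagrams_def id_diagram_def)

lemma s_diagram_in [simp]:
  assumes "1 \<le> m" "m < r"
  shows "pa_basis (s_diagram r m) \<in> partition_algebra r"
proof -
  have "s_diagram r m \<in> diagrams r" using assms
    unfolding diagrams_def s_diagram_def partition_on_def disjoint_def through_blocks_def vertices_def
    by (auto simp: image_iff)
  thus ?thesis by (simp add: pa_basis_def partition_algebra_single)
qed

lemma p_half_diagram_in [simp]:
  assumes "1 \<le> m" "m < r"
  shows "pa_basis (p_half_diagram r m) \<in> partition_algebra r"
proof -
  have "p_half_diagram r m \<in> diagrams r" using assms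
    unfolding diagrams_def p_half_diagram_def partition_on_def disjoint_def through_blocks_def vertices_def
    by (auto simp: image_iff)
  thus ?thesis by (simp add: pa_basis_def partition_algebra_single)
qed

lemma p_diagram_in [simp]:
  assumes "1 \<le> m" "m \<le> r"
  shows "pa_basis (p_diagram r m) \<in> partition_algebra r"
proof -
  have "p_diagram r m \<in> diagrams r" using assms
    unfolding diagrams_def p_diagram_def partition_on_def disjoint_def through_blocks_def vertices_def
    by (auto simp: image_iff)
  thus ?thesis by (simp add: pa_basis_def partition_algebra_single)
qed

lemma L_sigma_in:
  "i \<le> r \<Longrightarrow> L_el r i \<in> partition_algebra r"
  "i \<le> r \<Longrightarrow> sigma_el r i \<in> partition_algebra r"
  by (induction r i and r i rule: L_el_sigma_el.induct) (auto simp: Let_def)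

lemma sigma_half_in: "i < r \<Longrightarrow> sigma_half_el r i \<in> partition_algebra r"
  by (induction r i rule: sigma_half_el.induct) (auto simp: Let_def L_sigma_in)

text \<open>
  Evaluating at an integer can be done before passing to the complex numbers.  Both maps involved
  are then visibly ring homomorphisms.
\<close>

lemma poly_of_int_poly:
  "poly (map_poly of_int c) (of_nat n) = (of_int (poly c (int n)) :: complex)"
  by (induction c) (simp_all add: map_poly_pCons)

lemma lookup_specialize:
  "Poly_Mapping.lookup (specialize n x) P = of_int (poly (Poly_Mapping.lookup x P) (int n))"
  by (simp add: specialize_def Poly_Mapping.map.rep_eq when_def poly_of_int_poly)

lemma specialize_0 [simp]: "specialize n 0 = 0"
  by (rule poly_mapping_eqI) (simp add: lookup_specialize)

lemma specialize_add: "specialize n (x + y) = specialize n x + specialize n y"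
  by (rule poly_mapping_eqI) (simp add: lookup_specialize lookup_add)

lemma specialize_uminus: "specialize n (- x) = pm_scale (- 1) (specialize n x)"
  by (rule poly_mapping_eqI) (simp add: lookup_specialize lookup_scale)

lemma specialize_sum: "specialize n (sum f A) = (\<Sum>i\<in>A. specialize n (f i))"
  by (induction A rule: infinite_finite_induct) (auto simp: specialize_add)

lemma specialize_single:
  "specialize n (Poly_Mapping.single P c) = Poly_Mapping.single P (of_int (poly c (int n)))"
  by (rule poly_mapping_eqI) (simp add: lookup_specialize lookup_single when_def)

lemma specialize_basis [simp]: "specialize n (pa_basis P) = pa_basis P"
  by (simp add: pa_basis_def specialize_single)

lemma keys_specialize: "Poly_Mapping.keys (specialize n x) \<subseteq> Poly_Mapping.keys x"
  by (auto simp: in_keys_iff lookup_specialize)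

lemma specialize_in:
  "x \<in> partition_algebra r \<Longrightarrow> specialize n x \<in> partition_algebra r"
  unfolding partition_algebra_def using keys_specialize by blast

text \<open>
  Both products use the same diagrams and the same numbers of deleted components; the evaluation
  is a ring homomorphism on coefficients and sends \<open>z\<close> to \<open>n\<close>.
\<close>

lemma specialize_mult:
  "specialize n (x \<star> y) = pa_mult (of_nat n) (specialize n x) (specialize n y)"
proof -
  have "specialize n (x \<star> y) =
      (\<Sum>P\<in>Poly_Mapping.keys x. \<Sum>Q\<in>Poly_Mapping.keys y. Poly_Mapping.single (diagram_comp P Q)
        (of_nat n ^ deleted_components P Q * Poly_Mapping.lookup (specialize n x) P
          * Poly_Mapping.lookup (specialize n y) Q))"
    by (simp add: z_mult_def pa_mult_def specialize_sum specialize_single lookup_specialize)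
  also have "\<dots> = pa_mult (of_nat n) (specialize n x) (specialize n y)"
    by (rule pa_mult_superset[symmetric]) (simp_all add: keys_specialize)
  finally show ?thesis .
qed


section \<open>The recursions with an anchored index\<close>

text \<open>
  The recursions are restated so that the generators involved are those at the positions \<open>m\<close>
  and \<open>m + 1\<close>, with \<open>m\<close> kept as a variable; the induction steps then rewrite with the induction
  hypotheses for \<open>m\<close> directly.
\<close>

lemma L_el_Suc:
  assumes "1 \<le> m"
  shows "L_el r (Suc m) = - (s_el r m \<star> L_el r m \<star> ph_el r m) - ph_el r m \<star> L_el r m \<star> s_el r m
      + ph_el r m \<star> L_el r m \<star> p_el r (Suc m) \<star> ph_el r m + s_el r m \<star> L_el r m \<star> s_el r m
      + sigma_el r (Suc m)"
  using assms by (cases m) (simp_all add: Let_def)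

lemma sigma_el_Suc_Suc:
  assumes "1 \<le> m"
  shows "sigma_el r (Suc (Suc m)) =
      s_el r m \<star> s_el r (Suc m) \<star> sigma_el r (Suc m) \<star> s_el r (Suc m) \<star> s_el r m
      + s_el r (Suc m) \<star> ph_el r m \<star> L_el r m \<star> s_el r (Suc m) \<star> ph_el r m \<star> s_el r (Suc m)
      + ph_el r m \<star> L_el r m \<star> s_el r (Suc m) \<star> ph_el r m
      - s_el r (Suc m) \<star> ph_el r m \<star> L_el r m \<star> s_el r m \<star> ph_el r (Suc m) \<star> p_el r (Suc m) \<star> ph_el r m
      - ph_el r m \<star> p_el r (Suc m) \<star> ph_el r (Suc m) \<star> s_el r m \<star> L_el r m \<star> ph_el r m \<star> s_el r (Suc m)"
  using assms by (cases m) (simp_all add: Let_def)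

lemma sigma_half_el_Suc:
  assumes "1 \<le> m"
  shows "sigma_half_el r (Suc m) =
      s_el r m \<star> s_el r (Suc m) \<star> sigma_half_el r m \<star> s_el r (Suc m) \<star> s_el r m
      + ph_el r m \<star> L_el r m \<star> s_el r (Suc m) \<star> ph_el r m \<star> s_el r (Suc m)
      + s_el r (Suc m) \<star> ph_el r m \<star> L_el r m \<star> s_el r (Suc m) \<star> ph_el r m
      - ph_el r m \<star> L_el r m \<star> s_el r m \<star> ph_el r (Suc m) \<star> p_el r (Suc m) \<star> ph_el r m
      - s_el r (Suc m) \<star> ph_el r m \<star> p_el r (Suc m) \<star> ph_el r (Suc m) \<star> s_el r m \<star> L_el r m \<star> ph_el r m \<star> s_el r (Suc m)"
  using assms by (cases m) (simp_all add: Let_def)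


section \<open>Basis words and their relabelling\<close>

text \<open>
  The formulas for \<open>L\<^sub>m\<close>, \<open>\<sigma>\<^bsub>m+1\<^esub>\<close> and \<open>\<sigma>\<^bsub>m+1/2\<^esub>\<close> all permute the values of the letters strictly before
  \<open>m\<close> in this way; they differ from the pivot position \<open>m\<close> on.
\<close>

definition relabel :: "nat \<Rightarrow> (nat \<Rightarrow> nat) \<Rightarrow> (nat \<Rightarrow> nat) \<Rightarrow> nat \<Rightarrow> nat" where
  "relabel m \<pi> f = (\<lambda>l. if l < m then \<pi> (f l) else f l)"

lemma relabel_upd [simp]: "m \<le> l \<Longrightarrow> relabel m \<pi> (f(l := v)) = (relabel m \<pi> f)(l := v)"
  by (auto simp: relabel_def fun_eq_iff)

lemma relabel_id [simp]: "relabel m id f = f"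
  by (simp add: relabel_def fun_eq_iff)

lemma tensor_prod_basis_cong:
  assumes "\<And>l. l \<in> {1..r} \<Longrightarrow> f l = g l"
  shows "tensor_prod r (\<lambda>l. basis_vec (f l)) = tensor_prod r (\<lambda>l. basis_vec (g l))"
proof -
  have "index_word r f = index_word r g"
    unfolding index_word_def using assms by (intro map_cong refl) (auto simp del: upt_Suc)
  thus ?thesis by (simp add: tensor_prod_basis)
qed

lemma swap_op_basis: "swap_op a b (basis_vec c) = basis_vec (transpose a b c)"
  by (simp add: swap_op_def basis_vec_def)


section \<open>Linearity of the action\<close>

text \<open>
  The module axioms speak about the complex algebra and hold on its carriers only.  They are
  transported to the integral elements, as the recursions are stated there.
\<close>

locale tensor_representation =
  fixes n r :: nat
    and \<Phi> :: "(diagram \<Rightarrow>\<^sub>0 complex) \<Rightarrow> (nat list \<Rightarrow>\<^sub>0 complex) \<Rightarrow> (nat list \<Rightarrow>\<^sub>0 complex)"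
  assumes action: "tensor_action n r \<Phi>"
begin

definition act :: "pa_int \<Rightarrow> (nat list \<Rightarrow>\<^sub>0 complex) \<Rightarrow> (nat list \<Rightarrow>\<^sub>0 complex)" where
  "act x t = \<Phi> (specialize n x) t"

definition word :: "(nat \<Rightarrow> nat) \<Rightarrow> (nat list \<Rightarrow>\<^sub>0 complex)" where
  "word f = tensor_prod r (\<lambda>l. basis_vec (f l))"

definition letters :: "(nat \<Rightarrow> nat) \<Rightarrow> bool" where
  "letters f \<longleftrightarrow> (\<forall>l\<in>{1..r}. f l \<in> {1..n})"

lemma letters_upd [simp]: "letters f \<Longrightarrow> v \<in> {1..n} \<Longrightarrow> letters (f(l := v))"
  by (simp add: letters_def)

lemma letters_relabel [simp]:
  "letters f \<Longrightarrow> a \<in> {1..n} \<Longrightarrow> b \<in> {1..n} \<Longrightarrow> letters (relabel m (transpose a b) f)"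
  by (auto simp: letters_def relabel_def transpose_def)

lemma lettersD: "letters f \<Longrightarrow> 1 \<le> l \<Longrightarrow> l \<le> r \<Longrightarrow> f l \<in> {1..n}"
  by (simp add: letters_def)

lemma zero_in [simp]: "0 \<in> tensor_space n r"
  by (simp add: tensor_space_def)

lemma add_in: "t \<in> tensor_space n r \<Longrightarrow> u \<in> tensor_space n r \<Longrightarrow> t + u \<in> tensor_space n r"
  unfolding tensor_space_def using Poly_Mapping.keys_add[of t u] by blast

lemma sum_in [simp]:
  "(\<And>j. j \<in> A \<Longrightarrow> t j \<in> tensor_space n r) \<Longrightarrow> sum t A \<in> tensor_space n r"
  by (induction A rule: infinite_finite_induct) (auto simp: add_in)

lemma word_in [simp]: "letters f \<Longrightarrow> word f \<in> tensor_space n r"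
  using word_in_words[of r f n]
  by (simp add: word_def letters_def tensor_prod_basis tensor_space_def index_words_def)

lemma act_in [simp]:
  "x \<in> partition_algebra r \<Longrightarrow> t \<in> tensor_space n r \<Longrightarrow> act x t \<in> tensor_space n r"
  using action unfolding tensor_action_def act_def by (simp add: specialize_in)

lemma act_mult:
  "x \<in> partition_algebra r \<Longrightarrow> y \<in> partition_algebra r \<Longrightarrow> t \<in> tensor_space n r \<Longrightarrow>
    act (x \<star> y) t = act x (act y t)"
  using action
  unfolding tensor_action_def act_def specialize_mult by (simp add: specialize_in)

lemma act_add:
  "x \<in> partition_algebra r \<Longrightarrow> y \<in> partition_algebra r \<Longrightarrow> t \<in> tensor_space n r \<Longrightarrow>
    act (x + y) t = act x t + act y t"
  using action
  unfolding tensor_action_def act_def specialize_add by (simp add: specialize_in)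

lemma act_uminus:
  assumes "x \<in> partition_algebra r" "t \<in> tensor_space n r"
  shows "act (- x) t = - act x t"
proof -
  have "act (- x) t = pm_scale (- 1) (act x t)"
    using assms action
    unfolding tensor_action_def act_def specialize_uminus by (simp add: specialize_in)
  also have "\<dots> = - act x t" by (rule poly_mapping_eqI) (simp add: lookup_scale)
  finally show ?thesis .
qed

lemma act_diff:
  "x \<in> partition_algebra r \<Longrightarrow> y \<in> partition_algebra r \<Longrightarrow> t \<in> tensor_space n r \<Longrightarrow>
    act (x - y) t = act x t - act y t"
  using act_add[of x "- y" t] by (simp add: act_uminus)

lemma act_vector_add:
  "x \<in> partition_algebra r \<Longrightarrow> t \<in> tensor_space n r \<Longrightarrow> u \<in> tensor_space n r \<Longrightarrow>
    act x (t + u) = act x t + act x u"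
  using action unfolding tensor_action_def act_def by (simp add: specialize_in)

lemma act_vector_zero [simp]: "x \<in> partition_algebra r \<Longrightarrow> act x 0 = 0"
  using act_vector_add[of x 0 0] by simp

lemma act_vector_sum:
  "x \<in> partition_algebra r \<Longrightarrow> (\<And>j. j \<in> A \<Longrightarrow> t j \<in> tensor_space n r) \<Longrightarrow>
    act x (\<Sum>j\<in>A. t j) = (\<Sum>j\<in>A. act x (t j))"
  by (induction A rule: infinite_finite_induct) (auto simp: act_vector_add)

lemma act_vector_if:
  "x \<in> partition_algebra r \<Longrightarrow> act x (if c then t else 0) = (if c then act x t else 0)"
  by simp

lemmas act_linear = act_mult act_add act_diff act_uminus act_vector_sum act_vector_if

section \<open>Generators on words with two or three distinguished letters\<close>

lemma act_one: "t \<in> tensor_space n r \<Longrightarrow> act (one_el r) t = t"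
  using action unfolding tensor_action_def act_def specialize_basis by simp

lemma act_s:
  assumes "1 \<le> m" "m < r" "letters f"
  shows "act (s_el r m) (word f) = word (f(m := f (Suc m), Suc m := f m))"
proof -
  have "\<forall>l\<in>{1..r}. basis_vec (f l) \<in> V_space n"
    using assms(3) by (simp add: letters_def V_space_def basis_vec_def)
  hence "act (s_el r m) (word f) = tensor_prod r ((\<lambda>l. basis_vec (f l)) \<circ> transpose m (m + 1))"
    using assms action unfolding tensor_action_def act_def word_def specialize_basis by simp
  also have "(\<lambda>l. basis_vec (f l)) \<circ> transpose m (m + 1) =
      (\<lambda>l. basis_vec ((f(m := f (Suc m), Suc m := f m)) l))"
    by (auto simp: fun_eq_iff transpose_def)
  finally show ?thesis by (simp add: word_def)
qed

lemma act_ph: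
  assumes "1 \<le> m" "m < r" "letters f"
  shows "act (ph_el r m) (word f) = (if f m = f (Suc m) then word f else 0)"
proof -
  have "act (ph_el r m) (word f) = (if f m = f (m + 1) then word f else 0)"
    using assms action
    unfolding tensor_action_def act_def word_def letters_def specialize_basis by simp
  thus ?thesis by simp
qed

lemma act_p:
  assumes "1 \<le> m" "m \<le> r" "letters f"
  shows "act (p_el r m) (word f) = (\<Sum>j=1..n. word (f(m := j)))"
  using assms action
  unfolding tensor_action_def act_def word_def letters_def specialize_basis by simp


text \<open>
  With the letters near the pivot named explicitly, each generator becomes a rewrite rule that
  rearranges the named letters.
\<close>

definition pair :: "nat \<Rightarrow> (nat \<Rightarrow> nat) \<Rightarrow> nat \<Rightarrow> nat \<Rightarrow> nat \<Rightarrow> nat" where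
  "pair m f x y = f(m := x, Suc m := y)"

definition triple :: "nat \<Rightarrow> (nat \<Rightarrow> nat) \<Rightarrow> nat \<Rightarrow> nat \<Rightarrow> nat \<Rightarrow> nat \<Rightarrow> nat" where
  "triple m f x y z = f(m := x, Suc m := y, Suc (Suc m) := z)"

lemma letters_pair [simp]:
  "letters f \<Longrightarrow> x \<in> {1..n} \<Longrightarrow> y \<in> {1..n} \<Longrightarrow> letters (pair m f x y)"
  by (simp add: pair_def)

lemma letters_triple [simp]:
  "letters f \<Longrightarrow> x \<in> {1..n} \<Longrightarrow> y \<in> {1..n} \<Longrightarrow> z \<in> {1..n} \<Longrightarrow> letters (triple m f x y z)"
  by (simp add: triple_def)

lemma pair_self: "f = pair m f (f m) (f (Suc m))"
  by (simp add: pair_def)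

lemma triple_self: "f = triple m f (f m) (f (Suc m)) (f (Suc (Suc m)))"
  by (simp add: triple_def)

lemma act_s_pair:
  assumes "1 \<le> m" "m < r" "letters f" "x \<in> {1..n}" "y \<in> {1..n}"
  shows "act (s_el r m) (word (pair m f x y)) = word (pair m f y x)"
proof -
  have "(pair m f x y)(m := y, Suc m := x) = pair m f y x"
    by (auto simp: pair_def fun_eq_iff)
  moreover have "pair m f x y m = x" "pair m f x y (Suc m) = y" by (simp_all add: pair_def)
  ultimately show ?thesis using assms by (simp add: act_s)
qed

lemma act_ph_pair:
  assumes "1 \<le> m" "m < r" "letters f" "x \<in> {1..n}" "y \<in> {1..n}"
  shows "act (ph_el r m) (word (pair m f x y)) = (if x = y then word (pair m f x y) else 0)"
proof -
  have "pair m f x y m = x" "pair m f x y (Suc m) = y" by (simp_all add: pair_def)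
  thus ?thesis using assms by (simp add: act_ph)
qed

lemma act_p_pair:
  assumes "1 \<le> m" "m < r" "letters f" "x \<in> {1..n}" "y \<in> {1..n}"
  shows "act (p_el r (Suc m)) (word (pair m f x y)) = (\<Sum>j=1..n. word (pair m f x j))"
proof -
  have "(pair m f x y)(Suc m := j) = pair m f x j" for j
    by (auto simp: pair_def fun_eq_iff)
  thus ?thesis using assms by (simp add: act_p)
qed

text \<open>
  A generator at the first two or the last two positions sees a word with two named letters, so
  the rules for three letters are instances of those for two.
\<close>

lemma triple_first: "triple m f x y z = pair m (f(Suc (Suc m) := z)) x y"
  by (auto simp: pair_def triple_def fun_eq_iff)

lemma triple_last: "triple m f x y z = pair (Suc m) (f(m := x)) y z"
  by (auto simp: pair_def triple_def fun_eq_iff)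

lemma act_s_triple:
  assumes "1 \<le> m" "Suc (Suc m) \<le> r" "letters f" "x \<in> {1..n}" "y \<in> {1..n}" "z \<in> {1..n}"
  shows "act (s_el r m) (word (triple m f x y z)) = word (triple m f y x z)"
    and "act (s_el r (Suc m)) (word (triple m f x y z)) = word (triple m f x z y)"
  subgoal using assms unfolding triple_first by (simp add: act_s_pair)
  subgoal using assms unfolding triple_last by (simp add: act_s_pair)
  done

lemma act_ph_triple:
  assumes "1 \<le> m" "Suc (Suc m) \<le> r" "letters f" "x \<in> {1..n}" "y \<in> {1..n}" "z \<in> {1..n}"
  shows "act (ph_el r m) (word (triple m f x y z)) = (if x = y then word (triple m f x y z) else 0)"
    and "act (ph_el r (Suc m)) (word (triple m f x y z)) =
      (if y = z then word (triple m f x y z) else 0)"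
  subgoal using assms unfolding triple_first by (simp add: act_ph_pair)
  subgoal using assms unfolding triple_last by (simp add: act_ph_pair)
  done

lemma act_p_triple:
  assumes "1 \<le> m" "Suc (Suc m) \<le> r" "letters f" "x \<in> {1..n}" "y \<in> {1..n}" "z \<in> {1..n}"
  shows "act (p_el r (Suc m)) (word (triple m f x y z)) = (\<Sum>j=1..n. word (triple m f x j z))"
  using assms unfolding triple_first by (simp add: act_p_pair)

section \<open>The formulas and their consequences for named letters\<close>

definition L_formula :: "nat \<Rightarrow> bool" where
  "L_formula m \<longleftrightarrow> (\<forall>f. letters f \<longrightarrow>
    act (L_el r m) (word f) = (\<Sum>j=1..n. word ((relabel m (transpose (f m) j) f)(m := j))))"

text \<open>
  The transposition of the letters at \<open>m\<close> and \<open>m + 1\<close> exchanges these two letters; at \<open>m\<close> this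
  formula speaks about \<open>\<sigma>\<^bsub>m+1\<^esub>\<close>, so that it has the same pivot position as the formula for \<open>L\<^sub>m\<close>.
\<close>

definition sigma_formula :: "nat \<Rightarrow> bool" where
  "sigma_formula m \<longleftrightarrow> (\<forall>f. letters f \<longrightarrow>
    act (sigma_el r (Suc m)) (word f) =
      word (pair m (relabel m (transpose (f m) (f (Suc m))) f) (f (Suc m)) (f m)))"

definition sigma_half_formula :: "nat \<Rightarrow> bool" where
  "sigma_half_formula m \<longleftrightarrow> (\<forall>f. letters f \<longrightarrow>
    act (sigma_half_el r m) (word f) = word (relabel m (transpose (f m) (f (Suc m))) f))"

lemma L_pair:
  assumes "L_formula m" "letters f" "x \<in> {1..n}" "y \<in> {1..n}"
  shows "act (L_el r m) (word (pair m f x y)) =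
    (\<Sum>j=1..n. word (pair m (relabel m (transpose x j) f) j y))"
proof -
  have "(relabel m \<pi> (pair m f x y))(m := j) = pair m (relabel m \<pi> f) j y" for \<pi> j
    by (auto simp: pair_def relabel_def fun_eq_iff)
  moreover have "pair m f x y m = x" by (simp add: pair_def)
  ultimately show ?thesis using assms by (simp add: L_formula_def)
qed

lemma L_triple:
  assumes "L_formula m" "letters f" "x \<in> {1..n}" "y \<in> {1..n}" "z \<in> {1..n}"
  shows "act (L_el r m) (word (triple m f x y z)) =
    (\<Sum>j=1..n. word (triple m (relabel m (transpose x j) f) j y z))"
  using assms unfolding triple_first by (simp add: L_pair)

lemma sigma_pair:
  assumes "sigma_formula m" "letters f" "x \<in> {1..n}" "y \<in> {1..n}"
  shows "act (sigma_el r (Suc m)) (word (pair m f x y)) =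
    word (pair m (relabel m (transpose x y) f) y x)"
proof -
  have "pair m (relabel m \<pi> (pair m f x y)) u v = pair m (relabel m \<pi> f) u v" for \<pi> u v
    by (auto simp: pair_def relabel_def fun_eq_iff)
  moreover have "pair m f x y m = x" "pair m f x y (Suc m) = y" by (simp_all add: pair_def)
  ultimately show ?thesis using assms by (simp add: sigma_formula_def)
qed

lemma sigma_triple:
  assumes "sigma_formula m" "letters f" "x \<in> {1..n}" "y \<in> {1..n}" "z \<in> {1..n}"
  shows "act (sigma_el r (Suc m)) (word (triple m f x y z)) =
    word (triple m (relabel m (transpose x y) f) y x z)"
  using assms unfolding triple_first by (simp add: sigma_pair)

lemma sigma_half_triple:
  assumes "sigma_half_formula m" "letters f" "x \<in> {1..n}" "y \<in> {1..n}" "z \<in> {1..n}"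
  shows "act (sigma_half_el r m) (word (triple m f x y z)) =
    word (triple m (relabel m (transpose x y) f) x y z)"
proof -
  have "relabel m \<pi> (triple m f x y z) = triple m (relabel m \<pi> f) x y z" for \<pi>
    by (simp add: triple_def)
  moreover have "triple m f x y z m = x" "triple m f x y z (Suc m) = y" by (simp_all add: triple_def)
  ultimately show ?thesis using assms by (simp add: sigma_half_formula_def)
qed

section \<open>The induction\<close>

text \<open>
  Write \<open>x, y\<close> for the letters at \<open>m, m + 1\<close>.  If \<open>x = y\<close>, the product with a generator
  \<open>p\<^bsub>m+1/2\<^esub>\<close> on the right only cancels \<open>s\<^sub>m L\<^sub>m s\<^sub>m\<close>, the product with it on the left only cancels
  \<open>\<sigma>\<^bsub>m+1\<^esub>\<close>, and \<open>p\<^bsub>m+1/2\<^esub> L\<^sub>m p\<^bsub>m+1\<^esub> p\<^bsub>m+1/2\<^esub>\<close> is the whole sum.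
  If \<open>x \<noteq> y\<close>, the sum comes from \<open>s\<^sub>m L\<^sub>m s\<^sub>m\<close>; its term with \<open>j = x\<close> is wrong, is removed by
  \<open>p\<^bsub>m+1/2\<^esub> L\<^sub>m s\<^sub>m\<close>, and is replaced by the contribution of \<open>\<sigma>\<^bsub>m+1\<^esub>\<close>.
\<close>

lemma L_step:
  assumes m: "1 \<le> m" "m < r" and L: "L_formula m" and sigma: "sigma_formula m"
  shows "L_formula (Suc m)"
  unfolding L_formula_def
proof (intro allI impI)
  fix f assume f: "letters f"
  define x y where "x = f m" and "y = f (Suc m)"
  have xy: "x \<in> {1..n}" "y \<in> {1..n}" using m lettersD[OF f] by (simp_all add: x_def y_def)
  define R where "R a b = relabel m (transpose a b) f" for a b
  have L_in: "L_el r m \<in> partition_algebra r" and sigma_in: "sigma_el r (Suc m) \<in> partition_algebra r"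
    using m by (simp_all add: L_sigma_in)
  note rules = act_linear act_s_pair act_ph_pair act_p_pair L_pair[OF L] sigma_pair[OF sigma] L_in sigma_in
  have "act (L_el r (Suc m)) (word f) = act (L_el r (Suc m)) (word (pair m f x y))"
    unfolding x_def y_def using pair_self by metis
  also have "\<dots> = (\<Sum>j=1..n. word (pair m (R y j) (transpose y j x) j))"
  proof (cases "x = y")
    case True
    show ?thesis using m f xy unfolding True
      by (simp add: L_el_Suc R_def rules del: atLeastAtMost_iff)
  next
    case False
    \<comment> \<open>\<open>F\<close> is the summand of \<open>s\<^sub>m L\<^sub>m s\<^sub>m\<close> and \<open>G\<close> the required one; they differ only at \<open>j = x\<close>.\<close>
    define F G where "F j = word (pair m (R y j) x j)"
      and "G j = word (pair m (R y j) (transpose y j x) j)" for j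
    have FG: "F j = G j" if "j \<noteq> x" for j
      using that False by (simp add: F_def G_def)
    have "act (L_el r (Suc m)) (word (pair m f x y)) = (\<Sum>j=1..n. F j) - F x + G x"
      using m f xy False
      by (simp add: L_el_Suc R_def F_def G_def transpose_commute rules del: atLeastAtMost_iff)
    also have "\<dots> = (\<Sum>j=1..n. G j)"
      using sum.remove[OF finite_atLeastAtMost xy(1), of F] sum.remove[OF finite_atLeastAtMost xy(1), of G]
      by (simp add: FG)
    finally show ?thesis by (simp add: G_def)
  qed
  also have "\<dots> = (\<Sum>j=1..n. word ((relabel (Suc m) (transpose (f (Suc m)) j) f)(Suc m := j)))"
    by (intro sum.cong refl arg_cong[of _ _ word])
       (auto simp: pair_def relabel_def R_def x_def y_def fun_eq_iff)
  finally show "act (L_el r (Suc m)) (word f) =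
    (\<Sum>j=1..n. word ((relabel (Suc m) (transpose (f (Suc m)) j) f)(Suc m := j)))" .
qed

text \<open>
  On the word with letters \<open>x, y, z\<close>, and up to applying \<open>s\<^bsub>y,z\<^esub>\<close> to the letters before them, the
  five products of the recursion yield \<open>x z y\<close> always, \<open>y z y\<close> if \<open>x = z\<close>, \<open>z z y\<close> if \<open>x = y\<close>, and,
  with a minus sign, \<open>y z y\<close> if \<open>x = y\<close> and \<open>z z y\<close> if \<open>x = z\<close>.  In each of the cases
  for \<open>x\<close> their sum is \<open>s\<^bsub>y,z\<^esub> x\<close> followed by \<open>z y\<close>.
\<close>

lemma sigma_step:
  assumes m: "1 \<le> m" "Suc (Suc m) \<le> r" and L: "L_formula m" and sigma: "sigma_formula m"
  shows "sigma_formula (Suc m)"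
  unfolding sigma_formula_def
proof (intro allI impI)
  fix f assume f: "letters f"
  define x y z where "x = f m" and "y = f (Suc m)" and "z = f (Suc (Suc m))"
  have xyz: "x \<in> {1..n}" "y \<in> {1..n}" "z \<in> {1..n}"
    using m lettersD[OF f] by (simp_all add: x_def y_def z_def)
  have L_in: "L_el r m \<in> partition_algebra r" and sigma_in: "sigma_el r (Suc m) \<in> partition_algebra r"
    using m by (simp_all add: L_sigma_in)
  note rules = act_linear act_s_triple act_ph_triple act_p_triple L_triple[OF L] sigma_triple[OF sigma] L_in sigma_in
  have "act (sigma_el r (Suc (Suc m))) (word f) = act (sigma_el r (Suc (Suc m))) (word (triple m f x y z))"
    unfolding x_def y_def z_def using triple_self by metis
  also have "\<dots> = word (triple m (relabel m (transpose y z) f) (transpose y z x) z y)"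
    using m f xyz
      by (simp add: sigma_el_Suc_Suc transpose_commute rules del: atLeastAtMost_iff)
  also have "triple m (relabel m (transpose y z) f) (transpose y z x) z y =
      pair (Suc m) (relabel (Suc m) (transpose (f (Suc m)) (f (Suc (Suc m)))) f) (f (Suc (Suc m))) (f (Suc m))"
    by (auto simp: pair_def triple_def relabel_def x_def y_def z_def fun_eq_iff)
  finally show "act (sigma_el r (Suc (Suc m))) (word f) = word (pair (Suc m)
    (relabel (Suc m) (transpose (f (Suc m)) (f (Suc (Suc m)))) f) (f (Suc (Suc m))) (f (Suc m)))" .
qed

text \<open>
  Each of the four products containing \<open>L\<^sub>m\<close> is, after cancelling \<open>s\<^bsub>m+1\<^esub>\<^sup>2 = 1\<close>, the corresponding one
  in the recursion for \<open>\<sigma>\<^bsub>m+2\<^esub>\<close> multiplied by \<open>s\<^bsub>m+1\<^esub>\<close> on the left.  So they yield the words of the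
  preceding lemma with the last two letters exchanged, and the same holds for the first product
  because \<open>\<sigma>\<^bsub>m+1/2\<^esub>\<close> keeps the two letters that \<open>\<sigma>\<^bsub>m+1\<^esub>\<close> exchanges.
\<close>

lemma sigma_half_step:
  assumes m: "1 \<le> m" "Suc (Suc m) \<le> r" and L: "L_formula m" and sigma: "sigma_half_formula m"
  shows "sigma_half_formula (Suc m)"
  unfolding sigma_half_formula_def
proof (intro allI impI)
  fix f assume f: "letters f"
  define x y z where "x = f m" and "y = f (Suc m)" and "z = f (Suc (Suc m))"
  have xyz: "x \<in> {1..n}" "y \<in> {1..n}" "z \<in> {1..n}"
    using m lettersD[OF f] by (simp_all add: x_def y_def z_def)
  have L_in: "L_el r m \<in> partition_algebra r" and sigma_in: "sigma_half_el r m \<in> partition_algebra r"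
    using m by (simp_all add: L_sigma_in sigma_half_in)
  note rules = act_linear act_s_triple act_ph_triple act_p_triple L_triple[OF L]
    sigma_half_triple[OF sigma] L_in sigma_in
  have "act (sigma_half_el r (Suc m)) (word f) = act (sigma_half_el r (Suc m)) (word (triple m f x y z))"
    unfolding x_def y_def z_def using triple_self by metis
  also have "\<dots> = word (triple m (relabel m (transpose y z) f) (transpose y z x) y z)"
    using m f xyz by (simp add: sigma_half_el_Suc transpose_commute rules del: atLeastAtMost_iff)
  also have "triple m (relabel m (transpose y z) f) (transpose y z x) y z =
      relabel (Suc m) (transpose (f (Suc m)) (f (Suc (Suc m)))) f"
    by (auto simp: triple_def relabel_def x_def y_def z_def fun_eq_iff)
  finally show "act (sigma_half_el r (Suc m)) (word f) =
    word (relabel (Suc m) (transpose (f (Suc m)) (f (Suc (Suc m)))) f)" .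
qed

text \<open>There are no letters before the first position, which settles all three base cases.\<close>

lemma word_relabel_one:
  shows "word (relabel 1 \<pi> f) = word f" "word ((relabel 1 \<pi> f)(k := v)) = word (f(k := v))"
    "word (pair k (relabel 1 \<pi> f) u v) = word (pair k f u v)"
  unfolding word_def pair_def
  by (rule tensor_prod_basis_cong; simp add: relabel_def)+

lemma L_formula_one: "1 \<le> r \<Longrightarrow> L_formula 1"
  using act_p[of 1] by (simp add: L_formula_def word_relabel_one[unfolded One_nat_def])

lemma sigma_formula_one: "1 < r \<Longrightarrow> sigma_formula 1"
  using act_s[of 1, folded pair_def] by (simp add: sigma_formula_def word_relabel_one[unfolded One_nat_def])

lemma sigma_half_formula_one: "sigma_half_formula 1"
  by (simp add: sigma_half_formula_def word_relabel_one[unfolded One_nat_def] act_one)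

lemma L_sigma_formula:
  assumes "1 \<le> m" "m < r"
  shows "L_formula m \<and> sigma_formula m"
  using assms
proof (induction m rule: dec_induct)
  case base
  then show ?case using L_formula_one sigma_formula_one by simp
next
  case (step m)
  then show ?case using L_step[of m] sigma_step[of m] by simp
qed

lemma sigma_half_formula:
  assumes "1 \<le> m" "m < r"
  shows "sigma_half_formula m"
  using assms
proof (induction m rule: dec_induct)
  case base
  show ?case by (rule sigma_half_formula_one)
next
  case (step m)
  then show ?case using sigma_half_step[of m] L_sigma_formula[of m] by simp
qed

lemma act_sigma:
  assumes "1 \<le> m" "m < r" "letters f"
  shows "act (sigma_el r (m + 1)) (word f) =
    word (pair m (relabel m (transpose (f m) (f (m + 1))) f) (f (m + 1)) (f m))"
  using L_sigma_formula[of m] assms by (simp add: sigma_formula_def)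

lemma act_sigma_half:
  assumes "1 \<le> m" "m < r" "letters f"
  shows "act (sigma_half_el r m) (word f) = word (relabel m (transpose (f m) (f (m + 1))) f)"
  using sigma_half_formula[of m] assms by (simp add: sigma_half_formula_def)

end

theorem proposition5p2:
  fixes n k :: nat
    and i :: "nat \<Rightarrow> nat"
    and \<Phi> :: "(diagram \<Rightarrow>\<^sub>0 complex) \<Rightarrow> (nat list \<Rightarrow>\<^sub>0 complex) \<Rightarrow> (nat list \<Rightarrow>\<^sub>0 complex)"
  assumes "n \<ge> 1"
    and "k \<ge> 1"
    and "\<forall>l\<in>{1..k + 1}. i l \<in> {1..n}"
    and "tensor_action n (k + 1) \<Phi>"
  shows "\<Phi> (specialize n (sigma_half_el (k + 1) k)) (tensor_prod (k + 1) (\<lambda>l. basis_vec (i l))) =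
           tensor_prod (k + 1)
             (\<lambda>l. if l < k then swap_op (i k) (i (k + 1)) (basis_vec (i l)) else basis_vec (i l)) \<and>
         \<Phi> (specialize n (sigma_el (k + 1) (k + 1))) (tensor_prod (k + 1) (\<lambda>l. basis_vec (i l))) =
           tensor_prod (k + 1) (\<lambda>l. swap_op (i k) (i (k + 1)) (basis_vec (i l)))"
proof -
  interpret tensor_representation n "k + 1" \<Phi>
    using assms(4) by unfold_locales
  let ?\<tau> = "transpose (i k) (i (k + 1))"
  have i: "letters i" using assms(3) unfolding letters_def .
  have "act (sigma_half_el (k + 1) k) (word i) = word (relabel k ?\<tau> i)"
    by (rule act_sigma_half) (use assms(2) i in auto)
  also have "\<dots> = tensor_prod (k + 1) (\<lambda>l. if l < k then swap_op (i k) (i (k + 1)) (basis_vec (i l)) else basis_vec (i l))"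
    unfolding word_def relabel_def swap_op_basis if_distrib[of basis_vec] ..
  finally have half: "act (sigma_half_el (k + 1) k) (word i) =
    tensor_prod (k + 1) (\<lambda>l. if l < k then swap_op (i k) (i (k + 1)) (basis_vec (i l)) else basis_vec (i l))" .
  have "act (sigma_el (k + 1) (k + 1)) (word i) =
      word (pair k (relabel k ?\<tau> i) (i (k + 1)) (i k))"
    by (rule act_sigma) (use assms(2) i in auto)
  also have "\<dots> = tensor_prod (k + 1) (\<lambda>l. swap_op (i k) (i (k + 1)) (basis_vec (i l)))"
    unfolding word_def swap_op_basis
    by (rule tensor_prod_basis_cong) (auto simp: pair_def relabel_def)
  finally show ?thesis
    using half by (simp only: act_def word_def)
qed

end
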